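(* Let $p$ be a prime, $q=p^l$, $n\ge 2$ and $k\ge1$ integers, and suppose $\gcd(k,q-1)=1$. Then: (a) If $q=3$ and $3\nmid k$, then every matrix in $M_n(\mathbb F_q)$ is of the form $A^k+B^k$ with $A,B\in GL_n(\mathbb F_q)$. (b) If $q\ge 3$, then every matrix in $M_n(\mathbb F_q)$ is of the form $A^k+B^k$ with $A,B\in M_n(\mathbb F_q)$ split semisimple. (c) If $q\ge 4$, then every matrix in $M_n(\mathbb F_q)$ is of the form $A^k+B^k$ with $A,B\in GL_n(\mathbb F_q)$ split semisimple.
   Context: A matrix over a field $K$ is split semisimple (diagonalizable) if its minimal polynomial is a product of distinct monic polynomials of degree $1$ in $K[x]$. *)

theory Defs
  imports
    "HOL-Library.Cardinality"
    "HOL-Computational_Algebra.Primes"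
    "Jordan_Normal_Form.Determinant"
begin

definition poly_eval_mat :: "'a::comm_ring_1 poly \<Rightarrow> 'a mat \<Rightarrow> 'a mat" where
  "poly_eval_mat f A =
     mat (dim_row A) (dim_row A) (\<lambda>(i, j). \<Sum>r\<le>degree f. coeff f r * (A ^\<^sub>m r) $$ (i, j))"

definition min_poly :: "'a::field mat \<Rightarrow> 'a poly" where
  "min_poly A = (THE m. lead_coeff m = 1 \<and>
     (\<forall>f. poly_eval_mat f A = 0\<^sub>m (dim_row A) (dim_row A) \<longleftrightarrow> m dvd f))"

definition split_semisimple :: "'a::field mat \<Rightarrow> bool" where
  "split_semisimple A \<longleftrightarrow>
     (\<exists>F. finite F \<and> (\<forall>f\<in>F. lead_coeff f = 1 \<and> degree f = 1) \<and> min_poly A = \<Prod>F)"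

text \<open>The description in \<^const>\<open>min_poly\<close> is proper for every square matrix.\<close>

lemma poly_eval_mat_index:
  assumes "A \<in> carrier_mat n n" "i < n" "j < n" "degree f \<le> N"
  shows "poly_eval_mat f A $$ (i, j) = (\<Sum>r\<le>N. coeff f r * (A ^\<^sub>m r) $$ (i, j))"
proof -
  have "(\<Sum>r\<le>N. coeff f r * (A ^\<^sub>m r) $$ (i, j)) = (\<Sum>r\<le>degree f. coeff f r * (A ^\<^sub>m r) $$ (i, j))"
    by (intro sum.mono_neutral_right) (use assms in \<open>auto simp: Polynomial.coeff_eq_0\<close>)
  thus ?thesis using assms by (simp add: poly_eval_mat_def)
qed

lemma poly_eval_mat_eq_0_iff:
  assumes "A \<in> carrier_mat n n" "degree f \<le> N"
  shows "poly_eval_mat f A = 0\<^sub>m n n \<longleftrightarrow>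
    (\<forall>i<n. \<forall>j<n. (\<Sum>r\<le>N. coeff f r * (A ^\<^sub>m r) $$ (i, j)) = 0)" (is "?L \<longleftrightarrow> ?R")
proof
  assume ?L
  thus ?R using poly_eval_mat_index[OF assms(1) _ _ assms(2)] by (metis index_zero_mat(1))
next
  assume ?R
  thus ?L using poly_eval_mat_index[OF assms(1) _ _ assms(2)] assms(1)
    by (intro eq_matI) (auto simp: poly_eval_mat_def)
qed

lemma poly_eval_mat_0_add_smult:
  assumes "A \<in> carrier_mat n n" "poly_eval_mat f A = 0\<^sub>m n n" "poly_eval_mat g A = 0\<^sub>m n n"
  shows "poly_eval_mat (f + Polynomial.smult c g) A = 0\<^sub>m n n"
proof -
  define N where "N = max (degree f) (degree g)"
  have N: "degree f \<le> N" "degree g \<le> N" "degree (f + Polynomial.smult c g) \<le> N"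
    by (auto simp: N_def intro!: degree_add_le order_trans[OF degree_smult_le])
  have "(\<Sum>r\<le>N. coeff (f + Polynomial.smult c g) r * (A ^\<^sub>m r) $$ (i, j)) =
      (\<Sum>r\<le>N. coeff f r * (A ^\<^sub>m r) $$ (i, j)) +
      c * (\<Sum>r\<le>N. coeff g r * (A ^\<^sub>m r) $$ (i, j))" for i j
    by (simp add: distrib_right sum.distrib sum_distrib_left mult.assoc)
  thus ?thesis
    using assms(2,3)
    by (simp add: poly_eval_mat_eq_0_iff[OF assms(1) N(1)]
        poly_eval_mat_eq_0_iff[OF assms(1) N(2)] poly_eval_mat_eq_0_iff[OF assms(1) N(3)])
qed

lemma poly_eval_mat_0_shift:
  assumes A: "A \<in> carrier_mat n n" and f: "poly_eval_mat f A = 0\<^sub>m n n"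
  shows "poly_eval_mat (pCons 0 f) A = 0\<^sub>m n n"
proof -
  have d: "degree (pCons 0 f) \<le> Suc (degree f)" by (rule degree_pCons_le)
  have pow: "A ^\<^sub>m r \<in> carrier_mat n n" for r using A by simp
  have "(\<Sum>r\<le>Suc (degree f). coeff (pCons 0 f) r * (A ^\<^sub>m r) $$ (i, j)) = 0"
    if ij: "i < n" "j < n" for i j
  proof -
    have "(\<Sum>r\<le>Suc (degree f). coeff (pCons 0 f) r * (A ^\<^sub>m r) $$ (i, j))
        = (\<Sum>r\<le>degree f. coeff f r * (A ^\<^sub>m r * A) $$ (i, j))"
      by (simp add: sum.atMost_Suc_shift del: sum.atMost_Suc)
    also have "\<dots> = (\<Sum>r\<le>degree f. \<Sum>s<n. coeff f r * (A ^\<^sub>m r) $$ (i, s) * A $$ (s, j))"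
      using ij A pow
      by (intro sum.cong refl)
        (simp add: scalar_prod_def sum_distrib_left mult.assoc atLeast0LessThan)
    also have "\<dots> = (\<Sum>s<n. (\<Sum>r\<le>degree f. coeff f r * (A ^\<^sub>m r) $$ (i, s)) * A $$ (s, j))"
      by (subst sum.swap) (simp add: sum_distrib_right)
    also have "\<dots> = 0"
      using f[unfolded poly_eval_mat_eq_0_iff[OF A order_refl]] ij by simp
    finally show ?thesis .
  qed
  thus ?thesis unfolding poly_eval_mat_eq_0_iff[OF A d] by blast
qed

lemma poly_eval_mat_0_mult:
  assumes A: "A \<in> carrier_mat n n" and f: "poly_eval_mat f A = 0\<^sub>m n n"
  shows "poly_eval_mat (g * f) A = 0\<^sub>m n n"
proof (induction g)
  case 0
  show ?case using A by (auto simp: poly_eval_mat_def)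
next
  case (pCons a g)
  show ?case
    using poly_eval_mat_0_add_smult[OF A poly_eval_mat_0_shift[OF A pCons.IH] f, of a]
    by (simp add: add.commute)
qed

lemma poly_eval_mat_annihilator:
  fixes A :: "'a::field mat"
  assumes A: "A \<in> carrier_mat n n"
  shows "\<exists>f. f \<noteq> 0 \<and> poly_eval_mat f A = 0\<^sub>m n n"
proof -
  define N where "N = Suc (n * n)"
  define M where "M = mat N N (\<lambda>(s, r). if s < n * n then (A ^\<^sub>m r) $$ (s div n, s mod n) else 0)"
  have M: "M \<in> carrier_mat N N" by (simp add: M_def)
  have "det M = 0"
    by (subst laplace_expansion_row[OF M, of "n * n"]) (auto simp: M_def N_def intro!: sum.neutral)
  then obtain v where v: "v \<in> carrier_vec N" "v \<noteq> 0\<^sub>v N" "M *\<^sub>v v = 0\<^sub>v N"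
    using det_0_iff_vec_prod_zero_field[OF M] by blast
  define f where "f = (\<Sum>r<N. Polynomial.monom (v $ r) r)"
  have cf: "coeff f r = (if r < N then v $ r else 0)" for r
    by (simp add: f_def coeff_sum)
  have df: "degree f \<le> n * n" by (rule degree_le) (simp add: cf N_def)
  have "f \<noteq> 0"
  proof
    assume "f = 0"
    hence "v $ r = 0" if "r < N" for r using cf[of r] that by simp
    with v(1) have "v = 0\<^sub>v N" by (intro eq_vecI) auto
    with v(2) show False by simp
  qed
  moreover have "(\<Sum>r\<le>n * n. coeff f r * (A ^\<^sub>m r) $$ (i, j)) = 0" if ij: "i < n" "j < n" for i j
  proof -
    define s where "s = i * n + j"
    have "Suc i * n \<le> n * n" using ij by (intro mult_right_mono) auto
    hence s: "s < n * n" using ij by (simp add: s_def)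
    have ds: "s div n = i" "s mod n = j" using ij by (auto simp: s_def)
    have "0 = (M *\<^sub>v v) $ s" using v(3) s by (simp add: N_def)
    also have "\<dots> = (\<Sum>r<N. (A ^\<^sub>m r) $$ (i, j) * v $ r)"
      using v(1) s ds by (simp add: M_def N_def scalar_prod_def atLeast0LessThan)
    also have "\<dots> = (\<Sum>r\<le>n * n. coeff f r * (A ^\<^sub>m r) $$ (i, j))"
      by (rule sum.cong) (auto simp: cf N_def)
    finally show ?thesis by simp
  qed
  ultimately show ?thesis using poly_eval_mat_eq_0_iff[OF A df] by blast
qed

lemma monic_dvd_antisym:
  fixes f g :: "'a::field poly"
  assumes "lead_coeff f = 1" "lead_coeff g = 1" "f dvd g" "g dvd f"
  shows "f = g"
proof -
  obtain h where h: "g = f * h" using assms(3) by (elim dvdE)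
  have nz: "f \<noteq> 0" "g \<noteq> 0" using assms(1,2) by auto
  hence "degree f = degree g" using assms(3,4) by (simp add: dvd_imp_degree_le antisym)
  moreover have "h \<noteq> 0" using h nz by auto
  ultimately have "degree h = 0" using h nz by (simp add: degree_mult_eq)
  then obtain c where c: "h = [:c:]" by (rule degree_eq_zeroE)
  have "lead_coeff h = 1" using assms(1,2) h by (simp add: lead_coeff_mult)
  with c h show ?thesis by simp
qed

lemma min_poly_ex1:
  fixes A :: "'a::field mat"
  assumes A: "A \<in> carrier_mat n n"
  shows "\<exists>!m. lead_coeff m = 1 \<and> (\<forall>f. poly_eval_mat f A = 0\<^sub>m n n \<longleftrightarrow> m dvd f)"
proof -
  define P where "P f \<longleftrightarrow> f \<noteq> 0 \<and> poly_eval_mat f A = 0\<^sub>m n n" for f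
  define g where "g = arg_min degree P"
  obtain f0 where "P f0" using poly_eval_mat_annihilator[OF A] by (auto simp: P_def)
  hence g: "P g" "\<And>f. P f \<Longrightarrow> degree g \<le> degree f"
    unfolding g_def by (auto intro: arg_min_natI arg_min_nat_le)
  have zero: "poly_eval_mat 0 A = 0\<^sub>m n n" using poly_eval_mat_0_mult[OF A, of g 0] g(1)
    by (simp add: P_def)
  define m where "m = Polynomial.smult (inverse (lead_coeff g)) g"
  have g0: "g \<noteq> 0" using g(1) by (simp add: P_def)
  have lm: "lead_coeff m = 1" using g0 by (simp add: m_def)
  have m0: "poly_eval_mat m A = 0\<^sub>m n n"
    using poly_eval_mat_0_add_smult[OF A zero, of g] g(1) by (simp add: P_def m_def)
  have dm: "degree m = degree g" using g0 by (simp add: m_def)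
  have "poly_eval_mat f A = 0\<^sub>m n n \<longleftrightarrow> m dvd f" for f
  proof
    assume f: "poly_eval_mat f A = 0\<^sub>m n n"
    have "f mod m = f + Polynomial.smult (-1) (f div m * m)" by (simp add: minus_div_mult_eq_mod)
    hence "poly_eval_mat (f mod m) A = 0\<^sub>m n n"
      using poly_eval_mat_0_add_smult[OF A f poly_eval_mat_0_mult[OF A m0]] by metis
    hence "f mod m = 0"
      using g(2)[of "f mod m"] degree_mod_less'[of m f] dm lm
      by (cases "m = 0"; cases "f mod m = 0") (auto simp: P_def)
    thus "m dvd f" by (simp add: dvd_eq_mod_eq_0)
  next
    assume "m dvd f"
    thus "poly_eval_mat f A = 0\<^sub>m n n"
      using poly_eval_mat_0_mult[OF A m0] by (metis dvdE mult.commute)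
  qed
  note m = this
  show ?thesis
  proof (rule ex1I[of _ m])
    fix m' assume m': "lead_coeff m' = 1 \<and> (\<forall>f. poly_eval_mat f A = 0\<^sub>m n n \<longleftrightarrow> m' dvd f)"
    hence "m dvd m'" "m' dvd m" using m by (metis dvd_refl)+
    with m' lm show "m' = m" by (intro monic_dvd_antisym) auto
  qed (use lm m in blast)
qed

lemma min_poly:
  fixes A :: "'a::field mat"
  assumes A: "A \<in> carrier_mat n n"
  shows "lead_coeff (min_poly A) = 1"
    and "poly_eval_mat f A = 0\<^sub>m n n \<longleftrightarrow> min_poly A dvd f"
proof -
  have "dim_row A = n" using A by simp
  hence "min_poly A = (THE m. lead_coeff m = 1 \<and> (\<forall>f. poly_eval_mat f A = 0\<^sub>m n n \<longleftrightarrow> m dvd f))"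
    by (simp only: min_poly_def)
  note * = theI'[OF min_poly_ex1[OF A], folded this]
  show "lead_coeff (min_poly A) = 1" using * by (rule conjunct1)
  show "poly_eval_mat f A = 0\<^sub>m n n \<longleftrightarrow> min_poly A dvd f" using * by blast
qed

end

theory Submission
  imports Defs "HOL-Library.Function_Algebras"
begin

text \<open>
  A diagonalizable matrix \<open>A\<close> over the field with \<open>q\<close> elements satisfies \<open>A\<^sup>q = A\<close>, so if \<open>k\<close> is
  invertible modulo \<open>q - 1\<close>, some power of \<open>A\<close> is a diagonalizable \<open>k\<close>-th root of \<open>A\<close>. Parts (b)
  and (c) thus reduce to writing a matrix as a sum of two diagonalizable matrices, with nonzero
  eigenvalues in case (c). Decomposing the space into cyclic modules over the polynomial ring
  leaves the case of a companion matrix, which is split by distributing its subdiagonal ones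
  alternately between the two summands.

  For part (a), a matrix over the field with three elements is the sum of an upper and a lower
  triangular matrix with diagonal entries \<open>1\<close> and \<open>-1\<close>. The square of each is unipotent, and
  cubing a unipotent matrix in characteristic 3 clears its first nonzero superdiagonal, so the
  order of each summand divides \<open>2 \<cdot> 3\<^sup>n\<close>, which is prime to \<open>k\<close>.
\<close>

section \<open>Operators that are sums of two diagonalizable ones\<close>

locale linear_operator = vector_space scale
  for scale :: "'a::field \<Rightarrow> 'v::ab_group_add \<Rightarrow> 'v" (infixr "*s" 75) +
  fixes T :: "'v \<Rightarrow> 'v"
  assumes linear_T: "Vector_Spaces.linear scale scale T"
begin

interpretation vp: vector_space_pair scale scale by unfold_locales

section \<open>Splitting an operator on a subspace, and direct sums of splittings\<close>

definition eigenvectors :: "'a set \<Rightarrow> ('v \<Rightarrow> 'v) \<Rightarrow> 'v set \<Rightarrow> 'v set" where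
  "eigenvectors S A U = {x \<in> U. \<exists>c\<in>S. A x = c *s x}"

text \<open>\<open>T\<close> restricted to \<open>U\<close> is a sum of two diagonalizable operators
  \<open>A\<close> and \<open>T - A\<close> with eigenvalues in \<open>S\<close>. Diagonalizability
  is expressed by spanning eigenvectors, so no basis or dimension enters. Later \<open>S\<close> is
  the whole field for (b) and its nonzero elements for (c).\<close>

definition splits :: "'a set \<Rightarrow> 'v set \<Rightarrow> bool" where
  "splits S U \<longleftrightarrow> (\<exists>A. Vector_Spaces.linear scale scale A \<and> A ` U \<subseteq> U \<and>
     U \<subseteq> span (eigenvectors S A U) \<and> U \<subseteq> span (eigenvectors S (\<lambda>x. T x - A x) U))"

lemma splits_zero: "splits S {0}"
  unfolding splits_def
  by (intro exI[of _ "\<lambda>x. 0"]) (auto simp: vp.linear_zero span_zero)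

lemma eigenvectors_span_mono:
  assumes "U \<subseteq> span (eigenvectors S A U)" "U \<subseteq> W" "\<And>x. x \<in> U \<Longrightarrow> A x = B x"
  shows "U \<subseteq> span (eigenvectors S B W)"
proof -
  have "eigenvectors S A U \<subseteq> eigenvectors S B W"
    using assms(2,3) by (auto simp: eigenvectors_def)
  from span_mono[OF this] assms(1) show ?thesis by blast
qed

text \<open>A basis \<open>B1\<close> of \<open>U1\<close> is extended by vectors of
  \<open>U2\<close>, and \<open>A\<close> is prescribed as \<open>A1\<close> on \<open>B1\<close>
  and \<open>A2\<close> on the new vectors. The \<open>B1\<close>-component of a vector of
  \<open>U2\<close> lies in both subspaces, hence is zero, so \<open>U2\<close> only sees the new
  vectors.\<close>

lemma linear_eq_on_complement:
  assumes U: "subspace U1" "subspace U2" "U1 \<inter> U2 = {0}"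
    and A: "Vector_Spaces.linear scale scale A1" "Vector_Spaces.linear scale scale A2"
  obtains A where "Vector_Spaces.linear scale scale A"
    "\<And>x. x \<in> U1 \<Longrightarrow> A x = A1 x" "\<And>x. x \<in> U2 \<Longrightarrow> A x = A2 x"
proof -
  obtain B1 where B1: "B1 \<subseteq> U1" "independent B1" "U1 \<subseteq> span B1"
    using maximal_independent_subset[of U1] by blast
  obtain B where B: "B1 \<subseteq> B" "B \<subseteq> B1 \<union> U2" "independent B" "B1 \<union> U2 \<subseteq> span B"
    using maximal_independent_subset_extend[of B1 "B1 \<union> U2"] B1(2) by blast
  obtain A where lA: "Vector_Spaces.linear scale scale A"
    and Ab: "\<forall>b\<in>B. A b = (if b \<in> B1 then A1 b else A2 b)"
    using vp.linear_independent_extend[OF B(3), of "\<lambda>b. if b \<in> B1 then A1 b else A2 b"] by blast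
  show thesis
  proof (rule that[OF lA])
    fix x assume "x \<in> U1"
    hence "x \<in> span B1" using B1(3) by blast
    thus "A x = A1 x"
      by (rule vp.linear_eq_on[OF lA A(1)]) (use Ab B(1) in auto)
  next
    fix x assume x: "x \<in> U2"
    have "x \<in> span (B1 \<union> (B - B1))" using B(1,4) x by (auto simp: Un_absorb1)
    then obtain y z where yz: "x = y + z" "y \<in> span B1" "z \<in> span (B - B1)"
      unfolding span_Un by blast
    have "z \<in> U2" using yz(3) span_minimal[of "B - B1" U2] B(2) U(2) by blast
    hence "y \<in> U2" using subspace_diff[OF U(2) x, of z] yz(1) by simp
    moreover have "y \<in> U1" using yz(2) span_minimal[OF B1(1) U(1)] by blast
    ultimately have "y = 0" using U(3) by blast
    hence "x \<in> span (B - B1)" using yz by simp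
    thus "A x = A2 x"
      by (rule vp.linear_eq_on[OF lA A(2)]) (use Ab in auto)
  qed
qed

lemma splits_direct_sum:
  assumes U: "subspace U1" "subspace U2" "U1 \<inter> U2 = {0}"
    and s: "splits S U1" "splits S U2"
  shows "splits S {x + y |x y. x \<in> U1 \<and> y \<in> U2}"
proof -
  let ?U = "{x + y |x y. x \<in> U1 \<and> y \<in> U2}"
  obtain A1 where A1: "Vector_Spaces.linear scale scale A1" "A1 ` U1 \<subseteq> U1"
    "U1 \<subseteq> span (eigenvectors S A1 U1)" "U1 \<subseteq> span (eigenvectors S (\<lambda>x. T x - A1 x) U1)"
    using s(1) unfolding splits_def by blast
  obtain A2 where A2: "Vector_Spaces.linear scale scale A2" "A2 ` U2 \<subseteq> U2"
    "U2 \<subseteq> span (eigenvectors S A2 U2)" "U2 \<subseteq> span (eigenvectors S (\<lambda>x. T x - A2 x) U2)"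
    using s(2) unfolding splits_def by blast
  obtain A where A: "Vector_Spaces.linear scale scale A"
    "\<And>x. x \<in> U1 \<Longrightarrow> A x = A1 x" "\<And>x. x \<in> U2 \<Longrightarrow> A x = A2 x"
    using linear_eq_on_complement[OF U A1(1) A2(1)] by blast
  have sub: "U1 \<subseteq> ?U" "U2 \<subseteq> ?U"
    using subspace_0[OF U(1)] subspace_0[OF U(2)] by force+
  have sums: "?U \<subseteq> span X" if "U1 \<subseteq> span X" "U2 \<subseteq> span X" for X
    using that by (auto intro!: span_add)
  have "A ` ?U \<subseteq> ?U"
    using A1(2) A2(2) A(2,3) vp.linear_add[OF A(1)] by (fastforce simp: image_subset_iff)
  moreover have "?U \<subseteq> span (eigenvectors S A ?U)"
    by (rule sums) (rule eigenvectors_span_mono[OF A1(3)] eigenvectors_span_mono[OF A2(3)];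
        use sub A in auto)+
  moreover have "?U \<subseteq> span (eigenvectors S (\<lambda>x. T x - A x) ?U)"
    by (rule sums) (rule eigenvectors_span_mono[OF A1(4)] eigenvectors_span_mono[OF A2(4)];
        use sub A in auto)+
  ultimately show ?thesis unfolding splits_def using A(1) by blast
qed

section \<open>The space as a module over the polynomial ring, with the indeterminate acting as
  \<open>T\<close>\<close>

definition act :: "'a poly \<Rightarrow> 'v \<Rightarrow> 'v" where
  "act p x = fold_coeffs (\<lambda>a y. a *s x + T y) p 0"

lemma act_0 [simp]: "act 0 x = 0"
  by (simp add: act_def)

lemma act_pCons [simp]: "act (pCons a p) x = a *s x + T (act p x)"
  \<comment> \<open>For \<open>a = 0\<close> and \<open>p = 0\<close> the fold meets no coefficient,
    and the equation amounts to \<open>T 0 = 0\<close>.\<close>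
  using vp.linear_0[OF linear_T]
  by (cases "a = 0 \<and> p = 0") (auto simp: act_def)

lemma act_add_right: "act p (x + y) = act p x + act p y"
  by (induction p) (simp_all add: scale_right_distrib vp.linear_add[OF linear_T] algebra_simps)

lemma act_add_left: "act (p + q) x = act p x + act q x"
  by (induction p q rule: poly_induct2)
    (simp_all add: scale_left_distrib vp.linear_add[OF linear_T] algebra_simps)

lemma act_smult: "act (Polynomial.smult c p) x = c *s act p x"
  by (induction p) (simp_all add: scale_right_distrib vp.linear_scale[OF linear_T])

lemma act_mult: "act (p * q) x = act p (act q x)"
  by (induction p) (simp_all add: act_add_left act_smult)

lemma act_1 [simp]: "act 1 x = x"
  using vp.linear_0[OF linear_T] by (simp add: one_pCons)

lemma act_const [simp]: "act [:c:] x = c *s x"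
  using vp.linear_0[OF linear_T] by simp

lemma act_monom: "act (Polynomial.monom c i) x = c *s (T ^^ i) x"
  by (induction i) (simp_all add: monom_0 monom_Suc vp.linear_scale[OF linear_T] vp.linear_0[OF linear_T])

sublocale poly_module: Modules.module act
  by unfold_locales (simp_all add: act_add_right act_add_left act_mult)

lemma subspace_if_poly_subspace: "poly_module.subspace U \<Longrightarrow> subspace U"
  unfolding poly_module.subspace_def subspace_def by (metis act_const)

lemma act_sum_degree:
  assumes "degree p < d"
  shows "act p x = (\<Sum>i<d. coeff p i *s (T ^^ i) x)"
proof -
  have "p = (\<Sum>i<d. Polynomial.monom (coeff p i) i)"
    by (rule poly_eqI) (use assms in \<open>auto simp: coeff_sum coeff_eq_0\<close>)
  hence "act p x = act (\<Sum>i<d. Polynomial.monom (coeff p i) i) x" by simp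
  also have "\<dots> = (\<Sum>i<d. act (Polynomial.monom (coeff p i) i) x)"
    by (rule poly_module.scale_sum_left)
  finally show ?thesis by (simp add: act_monom)
qed

end

section \<open>Decomposition of finitely generated torsion modules into cyclic ones\<close>

text \<open>The coefficients are indexed by \<open>J\<close> rather than by the image, because a
  generating family may repeat a vector.\<close>

lemma (in Modules.module) span_image_finite_expansion:
  assumes "finite J" "x \<in> span (v ` J)"
  obtains e where "x = (\<Sum>j\<in>J. scale (e j) (v j))"
  using assms
proof (induction J arbitrary: x thesis rule: finite_induct)
  case (insert a J)
  obtain k where "x - scale k (v a) \<in> span (v ` J)"
    using insert.prems(2) by (auto simp: span_breakdown_eq)
  then obtain e where e: "x - scale k (v a) = (\<Sum>j\<in>J. scale (e j) (v j))"
    using insert.IH by blast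
  have "(\<Sum>j\<in>J. scale ((e(a := k)) j) (v j)) = (\<Sum>j\<in>J. scale (e j) (v j))"
    using insert.hyps(2) by (intro sum.cong) auto
  hence "x = (\<Sum>j\<in>insert a J. scale ((e(a := k)) j) (v j))"
    using insert.hyps e by (simp add: algebra_simps)
  thus ?case by (rule insert.prems(1))
qed simp

context linear_operator
begin

text \<open>Among all generating families of the module indexed by \<open>I\<close> and all their relations, a
  relation with a nonzero coefficient \<open>p\<close> of least degree has all its coefficients divisible by
  \<open>p\<close>. Absorbing the quotients into one generator \<open>w\<close> turns it into \<open>p w = 0\<close>, and
  minimality makes the submodule generated by \<open>w\<close> a direct summand.\<close>

lemma cyclic_summand:
  assumes I: "finite I" "I \<noteq> {}"
    and torsion: "\<And>x. \<exists>p. p \<noteq> 0 \<and> act p x = 0"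
  obtains u w i p where "i \<in> I"
    "poly_module.span (v ` I) = poly_module.span (insert w (u ` (I - {i})))"
    "p \<noteq> 0" "act p w = 0" "\<And>q. q \<noteq> 0 \<Longrightarrow> act q w = 0 \<Longrightarrow> degree p \<le> degree q"
    "poly_module.span {w} \<inter> poly_module.span (u ` (I - {i})) = {0}"
proof -
  \<comment> \<open>A triple in \<open>R\<close> is a generating family, a relation among its
    members, and an index whose coefficient is nonzero; the degree of that coefficient is minimized.
    Torsion of a single generator shows that \<open>R\<close> is inhabited.\<close>
  define R where "R = (\<lambda>(u, c, i). i \<in> I \<and> poly_module.span (u ` I) = poly_module.span (v ` I) \<and>
    c i \<noteq> 0 \<and> (\<Sum>j\<in>I. act (c j) (u j)) = 0)"
  define deg where "deg = (\<lambda>(u :: 'b \<Rightarrow> 'v, c :: 'b \<Rightarrow> 'a poly, i :: 'b). degree (c i))"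
  have single: "(\<Sum>j\<in>I. act (if j = i then p else 0) (u j)) = act p (u i)" if "i \<in> I" for i p u
  proof -
    have "(\<Sum>j\<in>I. act (if j = i then p else 0) (u j)) = (\<Sum>j\<in>I. if j = i then act p (u i) else 0)"
      by (rule sum.cong) auto
    thus ?thesis using I(1) that by simp
  qed
  obtain i0 where i0: "i0 \<in> I" using I(2) by blast
  obtain p0 where "p0 \<noteq> 0" "act p0 (v i0) = 0" using torsion by blast
  hence "R (v, \<lambda>j. if j = i0 then p0 else 0, i0)"
    using i0 single[of i0 p0 v] by (simp add: R_def)
  from arg_min_natI[of R, OF this, of deg] arg_min_nat_le[of R _ deg]
  obtain u c i where R: "R (u, c, i)" and min: "\<And>x. R x \<Longrightarrow> deg (u, c, i) \<le> deg x"
    by (metis prod_cases3)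
  define p where "p = c i"
  define J where "J = I - {i}"
  define w where "w = u i + (\<Sum>j\<in>J. act (c j div p) (u j))"
  have i: "i \<in> I" and p: "p \<noteq> 0" and rel: "(\<Sum>j\<in>I. act (c j) (u j)) = 0"
    and span_u: "poly_module.span (u ` I) = poly_module.span (v ` I)"
    using R by (auto simp: R_def p_def)
  have J: "finite J" "i \<notin> J" "I = insert i J" using I(1) i by (auto simp: J_def)
  have image: "(u(i := w)) ` I = insert w (u ` J)" using J by auto
  have "w - u i \<in> poly_module.span (u ` J)"
    unfolding w_def add_diff_cancel_left'
    by (rule poly_module.span_sum, rule poly_module.span_scale, rule poly_module.span_base) simp
  hence "poly_module.span (insert w (u ` J)) = poly_module.span (insert (u i) (u ` J))"
    by (rule poly_module.eq_span_insert_eq)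
  hence span_w: "poly_module.span ((u(i := w)) ` I) = poly_module.span (v ` I)"
    using span_u J(3) image by simp
  \<comment> \<open>The family \<open>u(i := w)\<close> generates the same module, so its relations
    compete for minimality: a coefficient of degree below that of \<open>p\<close> must
    vanish.\<close>
  have less: "e k = 0" if "k \<in> I" "degree (e k) < degree p \<or> e k = 0"
    "act (e i) w + (\<Sum>j\<in>J. act (e j) (u j)) = 0" for e k
  proof (rule ccontr)
    assume "e k \<noteq> 0"
    moreover have "(\<Sum>j\<in>I. act (e j) ((u(i := w)) j)) = act (e i) w + (\<Sum>j\<in>J. act (e j) (u j))"
      using J by (auto intro!: sum.cong)
    ultimately have "R (u(i := w), e, k)" using that(1,3) span_w by (simp add: R_def)
    from min[OF this] that(2) \<open>e k \<noteq> 0\<close> show False by (simp add: deg_def p_def)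
  qed
  have deg_mod: "degree (q mod p) < degree p \<or> q mod p = 0" for q
    using degree_mod_less'[of p q] p by blast
  let ?e = "\<lambda>j. if j = i then p else c j mod p"
  \<comment> \<open>The old relation, rewritten for \<open>w\<close>, has the remainders modulo
    \<open>p\<close> as its other coefficients; \<open>less\<close> kills them and leaves
    \<open>act p w = 0\<close>.\<close>
  have "act p w + (\<Sum>j\<in>J. act (c j mod p) (u j)) =
      act p (u i) + (\<Sum>j\<in>J. act (p * (c j div p) + c j mod p) (u j))"
    by (simp only: w_def act_add_right poly_module.scale_sum_right act_add_left act_mult sum.distrib
        add.assoc)
  also have "\<dots> = act (c i) (u i) + (\<Sum>j\<in>J. act (c j) (u j))"
    unfolding mult_div_mod_eq p_def ..
  also have "\<dots> = 0" using rel unfolding J(3) using J(1,2) by simp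
  finally have e: "act p w + (\<Sum>j\<in>J. act (c j mod p) (u j)) = 0" .
  have "(\<Sum>j\<in>J. act (?e j) (u j)) = (\<Sum>j\<in>J. act (c j mod p) (u j))"
    using J(2) by (intro sum.cong) auto
  hence "?e j = 0" if "j \<in> J" for j
    using less[of j ?e] that e deg_mod[of "c j"] J by auto
  hence "c j mod p = 0" if "j \<in> J" for j using that J(2) by metis
  hence pw: "act p w = 0" using e by simp
  \<comment> \<open>Since \<open>p\<close> annihilates \<open>w\<close>, the coefficient
    \<open>g\<close> may be reduced modulo \<open>p\<close>, after which \<open>less\<close> makes
    it zero. An element common to both submodules yields such a relation, so the sum is
    direct.\<close>
  have kill: "act g w = 0" if "act g w + (\<Sum>j\<in>J. act (e j) (u j)) = 0" for g e
  proof -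
    have *: "act g w = act (g mod p) w"
    proof -
      have "act g w = act (g div p * p + g mod p) w" by simp
      also have "\<dots> = act (g mod p) w" by (simp only: act_add_left act_mult pw) simp
      finally show ?thesis .
    qed
    have "(\<Sum>j\<in>J. act ((e(i := g mod p)) j) (u j)) = (\<Sum>j\<in>J. act (e j) (u j))"
      using J(2) by (intro sum.cong) auto
    hence "(e(i := g mod p)) i = 0"
      using that * deg_mod[of g] i by (intro less) auto
    thus ?thesis using * by simp
  qed
  show thesis
  proof (rule that[of i w u p])
    show "poly_module.span (v ` I) = poly_module.span (insert w (u ` (I - {i})))"
      using span_w image by (simp add: J_def)
    show "degree p \<le> degree q" if "q \<noteq> 0" "act q w = 0" for q
    proof (rule ccontr)
      assume "\<not> degree p \<le> degree q"
      moreover have "(\<Sum>j\<in>J. act (if j = i then q else 0) (u j)) = 0"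
        using J(2) by (intro sum.neutral) auto
      ultimately have "(if i = i then q else 0) = 0"
        using that i by (intro less[of i "\<lambda>j. if j = i then q else 0"]) auto
      thus False using that by simp
    qed
    have "x = 0" if x: "x \<in> poly_module.span {w}" "x \<in> poly_module.span (u ` J)" for x
    proof -
      obtain g where g: "x = act g w" using x(1) by (auto simp: poly_module.span_singleton)
      obtain e where e: "x = (\<Sum>j\<in>J. act (e j) (u j))"
        using poly_module.span_image_finite_expansion[OF J(1) x(2)] by blast
      have "act g w + (\<Sum>j\<in>J. act (- e j) (u j)) = 0"
        using g e by (simp add: sum_negf)
      from kill[OF this] show "x = 0" using g by simp
    qed
    thus "poly_module.span {w} \<inter> poly_module.span (u ` (I - {i})) = {0}"
      by (auto simp: J_def poly_module.span_zero)
  qed (use i p pw in auto)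
qed

text \<open>Induction on the number of generators: \<open>cyclic_summand\<close> splits off a cyclic
  direct summand and leaves one generator fewer.\<close>

lemma splits_finitely_generated:
  assumes I: "finite I"
    and torsion: "\<And>x. \<exists>p. p \<noteq> 0 \<and> act p x = 0"
    and cyclic: "\<And>w p. p \<noteq> 0 \<Longrightarrow> act p w = 0 \<Longrightarrow>
      (\<And>q. q \<noteq> 0 \<Longrightarrow> act q w = 0 \<Longrightarrow> degree p \<le> degree q) \<Longrightarrow> splits S (poly_module.span {w})"
  shows "splits S (poly_module.span (v ` I))"
  using I
proof (induction "card I" arbitrary: I v)
  case 0
  thus ?case by (simp add: splits_zero)
next
  case (Suc m)
  hence "I \<noteq> {}" by auto
  then obtain u w i p where i: "i \<in> I"
    and span: "poly_module.span (v ` I) = poly_module.span (insert w (u ` (I - {i})))"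
    and w: "splits S (poly_module.span {w})"
    and direct: "poly_module.span {w} \<inter> poly_module.span (u ` (I - {i})) = {0}"
    using cyclic_summand[OF Suc.prems _ torsion] cyclic by metis
  have "splits S (poly_module.span (u ` (I - {i})))"
    using Suc.hyps i Suc.prems by (metis card_Diff_singleton diff_Suc_1 finite_Diff)
  with w direct have "splits S {x + y |x y. x \<in> poly_module.span {w} \<and> y \<in> poly_module.span (u ` (I - {i}))}"
    by (intro splits_direct_sum subspace_if_poly_subspace poly_module.subspace_span)
  also have "{x + y |x y. x \<in> poly_module.span {w} \<and> y \<in> poly_module.span (u ` (I - {i}))} =
      poly_module.span (v ` I)"
    unfolding span using poly_module.span_Un[of "{w}" "u ` (I - {i})"] by simp
  finally show ?case .
qed

end

section \<open>Companion matrices and cyclic modules\<close>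

context linear_operator
begin

interpretation vp: vector_space_pair scale scale by unfold_locales

text \<open>On an eigenvector with eigenvalue \<open>b \<noteq> a\<close>, the operator
  \<open>A - a\<close> multiplies by \<open>b - a\<close>, so dividing by \<open>b - a\<close> gives
  a preimage; linearity extends this to the span.\<close>

lemma eigenvectors_span_preimage:
  assumes A: "Vector_Spaces.linear scale scale A"
    and y: "y \<in> span (eigenvectors (S - {a}) A U)"
  obtains u where "u \<in> span (eigenvectors (S - {a}) A U)" "A u - a *s u = y"
proof -
  let ?E = "span (eigenvectors (S - {a}) A U)"
  have "\<exists>u\<in>?E. A u - a *s u = y"
    using y
  proof (induction rule: span_induct_alt)
    case base
    show ?case by (rule bexI[of _ 0]) (simp_all add: span_zero vp.linear_0[OF A])
  next
    case (step c x y)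
    obtain u where u: "u \<in> ?E" "A u - a *s u = y" using step.IH by blast
    obtain b where b: "A x = b *s x" "b \<noteq> a" using step.hyps by (auto simp: eigenvectors_def)
    show ?case
    proof (rule bexI[of _ "(c / (b - a)) *s x + u"])
      show "(c / (b - a)) *s x + u \<in> ?E"
        using span_add[OF span_scale[OF span_base[OF step.hyps]] u(1)] .
      have "A ((c / (b - a)) *s x + u) - a *s ((c / (b - a)) *s x + u) =
          (c / (b - a) * b - a * (c / (b - a))) *s x + (A u - a *s u)"
        by (simp add: vp.linear_add[OF A] vp.linear_scale[OF A] b scale_left_diff_distrib
            scale_right_distrib)
      also have "c / (b - a) * b - a * (c / (b - a)) = (b - a) * (c / (b - a))"
        by (simp only: left_diff_distrib mult.commute[of "c / (b - a)" b])
      also have "\<dots> = c" using b(2) by simp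
      finally show "A ((c / (b - a)) *s x + u) - a *s ((c / (b - a)) *s x + u) = c *s x + y"
        using u(2) by simp
    qed
  qed
  thus thesis using that by blast
qed

text \<open>If \<open>u\<close> is a preimage of \<open>y\<close> under \<open>A - a\<close>, then
  \<open>x - u\<close> is an eigenvector for \<open>a\<close>. This is the step that diagonalizes
  triangular operators.\<close>

lemma in_span_eigenvectors:
  assumes A: "Vector_Spaces.linear scale scale A" and U: "subspace U" "x \<in> U" and "a \<in> S"
    and Ax: "A x = a *s x + y" and y: "y \<in> span (eigenvectors (S - {a}) A U)"
  shows "x \<in> span (eigenvectors S A U)"
proof -
  obtain u where u: "u \<in> span (eigenvectors (S - {a}) A U)" "A u - a *s u = y"
    using eigenvectors_span_preimage[OF A y] .
  have "span (eigenvectors (S - {a}) A U) \<subseteq> U"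
    by (rule span_minimal[OF _ U(1)]) (auto simp: eigenvectors_def)
  hence "x - u \<in> U" using u(1) U by (auto intro: subspace_diff)
  moreover have "A (x - u) = a *s (x - u)"
    using u(2) Ax by (simp add: vp.linear_diff[OF A] scale_right_diff_distrib algebra_simps)
  ultimately have "x - u \<in> span (eigenvectors S A U)"
    using \<open>a \<in> S\<close> by (intro span_base) (auto simp: eigenvectors_def)
  moreover have "u \<in> span (eigenvectors S A U)"
    using u(1) span_mono[of "eigenvectors (S - {a}) A U" "eigenvectors S A U"]
    by (auto simp: eigenvectors_def)
  ultimately show ?thesis using span_add by fastforce
qed

lemma eigenvector_in_span:
  assumes "x \<in> U" "A x = a *s x" "a \<in> S"
  shows "x \<in> span (eigenvectors S A U)"
  using assms by (intro span_base) (auto simp: eigenvectors_def)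

text \<open>On a basis \<open>e\<^sub>0, \<dots>, e\<^sub>d\<^sub>-\<^sub>1\<close> in which \<open>T\<close> is a companion matrix, every other
  arrow \<open>e\<^sub>i \<mapsto> e\<^sub>i\<^sub>+\<^sub>1\<close> is given to \<open>A\<close> and the remaining ones to \<open>T - A\<close>, so that
  both become block triangular with blocks of size at most two having distinct eigenvalues; the
  last column of \<open>T\<close> is given to \<open>T - A\<close>, where it adds one further, distinct eigenvalue.\<close>

lemma splits_companion:
  fixes e :: "nat \<Rightarrow> 'v"
  assumes inj: "inj_on e {..<d}" and indep: "independent (e ` {..<d})" and d: "d > 0"
    and T: "\<And>i. Suc i < d \<Longrightarrow> T (e i) = e (Suc i)" "T (e (d - 1)) = (\<Sum>i<d. c i *s e i)"
    and S: "{a, b, s, - a, - b, c (d - 1) - s} \<subseteq> S"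
    and ne: "a \<noteq> b" "a \<noteq> s" "c (d - 1) - s \<noteq> - a" "c (d - 1) - s \<noteq> - b"
  shows "splits S (span (e ` {..<d}))"
proof -
  let ?U = "span (e ` {..<d})"
  \<comment> \<open>Parity is counted from the end: the last vector is then an eigenvector of
    \<open>A\<close> for \<open>s\<close>, and the arrow into it belongs to \<open>A\<close>. Hence
    \<open>T - A\<close> maps no earlier vector to one with a component along the last, whose column
    can be treated separately.\<close>
  define f where "f i = (if i = d - 1 then s *s e i
    else if odd (d - 1 - i) then a *s e i + e (Suc i) else b *s e i)" for i
  obtain A where A: "Vector_Spaces.linear scale scale A"
    and "\<forall>x\<in>e ` {..<d}. A x = f (the_inv_into {..<d} e x)"
    using vp.linear_independent_extend[OF indep, of "\<lambda>x. f (the_inv_into {..<d} e x)"] by blast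
  hence Ae: "A (e i) = f i" if "i < d" for i
    using that inj by (simp add: the_inv_into_f_f)
  define N where "N x = T x - A x" for x
  have N: "Vector_Spaces.linear scale scale N"
    unfolding N_def by (rule vp.linear_compose_sub[OF linear_T A])
  have e: "e i \<in> ?U" if "i < d" for i using that by (intro span_base) auto
  have f: "f i \<in> ?U" if "i < d" for i
    using that d e[of i] e[of "Suc i"] unfolding f_def
    by (cases "i = d - 1") (auto intro!: span_add span_scale)
  have inv: "A ` ?U \<subseteq> ?U"
    unfolding vp.linear_span_image[OF A, symmetric]
    by (rule span_minimal) (use Ae f in auto)
  \<comment> \<open>A general \<open>S'\<close> is used because the fact is also needed with the
    eigenvalue \<open>a\<close> removed from \<open>S\<close>.\<close>
  have even_A: "e i \<in> span (eigenvectors S' A ?U)"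
    if "i < d" "even (d - 1 - i)" "{b, s} \<subseteq> S'" for i S'
  proof -
    have "A (e i) = s *s e i \<or> A (e i) = b *s e i" using Ae[OF that(1)] that(2) by (simp add: f_def)
    thus ?thesis using eigenvector_in_span[OF e[OF that(1)]] that(3) by blast
  qed
  have A_eig: "e i \<in> span (eigenvectors S A ?U)" if i: "i < d" for i
  proof (cases "even (d - 1 - i)")
    case True
    thus ?thesis using even_A[of i S] i S by auto
  next
    case False
    hence "d - 1 - i = Suc (d - 1 - Suc i)" using odd_pos[OF False] by simp
    hence "Suc i < d" "even (d - 1 - Suc i)" using False by simp_all
    hence "e (Suc i) \<in> span (eigenvectors (S - {a}) A ?U)"
      by (intro even_A) (use S ne in auto)
    moreover have "A (e i) = a *s e i + e (Suc i)" using Ae[OF i] False by (auto simp: f_def)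
    ultimately show ?thesis using in_span_eigenvectors[OF A subspace_span e[OF i]] S by blast
  qed
  have odd_N: "e i \<in> span (eigenvectors S' N ?U)"
    if i: "i < d" "odd (d - 1 - i)" and S': "- a \<in> S'" for i S'
  proof -
    have "i \<noteq> d - 1" "Suc i < d" using odd_pos[OF i(2)] by auto
    hence "N (e i) = (- a) *s e i" using Ae[of i] T(1)[of i] i by (auto simp: f_def N_def)
    thus ?thesis using e i S' by (intro eigenvector_in_span[where a = "- a"])
  qed
  \<comment> \<open>Leaving out the eigenvalue \<open>c (d - 1) - s\<close> prepares for the last
    vector: \<open>N\<close> maps it to this multiple of itself plus a combination of the vectors
    treated here.\<close>
  have N_eig': "e i \<in> span (eigenvectors (S - {c (d - 1) - s}) N ?U)" if i: "i < d - 1" for i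
  proof (cases "odd (d - 1 - i)")
    case True
    thus ?thesis using i S ne by (intro odd_N) auto
  next
    case False
    have i': "i < d" "Suc i < d" using i by auto
    have "d - 1 - i = Suc (d - 1 - Suc i)" using i by simp
    hence "odd (d - 1 - Suc i)" using False by simp
    hence "e (Suc i) \<in> span (eigenvectors (S - {c (d - 1) - s} - {- b}) N ?U)"
      using i' S ne by (intro odd_N) auto
    moreover have "N (e i) = (- b) *s e i + e (Suc i)"
      using Ae[OF i'(1)] T(1)[OF i'(2)] False i by (auto simp: f_def N_def)
    moreover have "- b \<in> S - {c (d - 1) - s}" using S ne by auto
    ultimately show ?thesis
      by (intro in_span_eigenvectors[OF N subspace_span e[OF i'(1)], of "- b" _ "e (Suc i)"])
  qed
  have "e (d - 1) \<in> span (eigenvectors S N ?U)"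
  proof (rule in_span_eigenvectors[OF N subspace_span])
    have "{..<d} = insert (d - 1) {..<d - 1}" using d by auto
    hence "T (e (d - 1)) = c (d - 1) *s e (d - 1) + (\<Sum>i<d - 1. c i *s e i)"
      unfolding T(2) by simp
    thus "N (e (d - 1)) = (c (d - 1) - s) *s e (d - 1) + (\<Sum>i<d - 1. c i *s e i)"
      using Ae[of "d - 1"] d by (simp add: N_def f_def scale_left_diff_distrib)
    show "(\<Sum>i<d - 1. c i *s e i) \<in> span (eigenvectors (S - {c (d - 1) - s}) N ?U)"
      using N_eig' by (intro span_sum span_scale) auto
  qed (use S d e in auto)
  moreover have "e i \<in> span (eigenvectors S N ?U)" if "i < d - 1" for i
    using N_eig'[OF that] span_mono[of "eigenvectors (S - {c (d - 1) - s}) N ?U" "eigenvectors S N ?U"]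
    by (auto simp: eigenvectors_def)
  ultimately have N_eig: "e i \<in> span (eigenvectors S N ?U)" if "i < d" for i
    using that by (cases "i = d - 1") auto
  have "?U \<subseteq> span (eigenvectors S A ?U)" by (rule span_minimal) (use A_eig in auto)
  moreover have "?U \<subseteq> span (eigenvectors S N ?U)" by (rule span_minimal) (use N_eig in auto)
  ultimately show ?thesis unfolding splits_def N_def using A inv by blast
qed

text \<open>The vectors \<open>(T ^^ i) w\<close> with \<open>i\<close> below the degree of
  \<open>p\<close> form a basis: division by \<open>p\<close> shows that they span, minimality of
  \<open>p\<close> that they are independent. In it \<open>T\<close> is a companion matrix;
  \<open>t\<close> stands for its last diagonal entry, which can be anything.\<close>

lemma splits_cyclic:
  assumes p: "p \<noteq> 0" "act p w = 0" and min: "\<And>q. q \<noteq> 0 \<Longrightarrow> act q w = 0 \<Longrightarrow> degree p \<le> degree q"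
    and S: "\<And>t. \<exists>a b s. {a, b, s, - a, - b, t - s} \<subseteq> S \<and> a \<noteq> b \<and> a \<noteq> s \<and> t - s \<noteq> - a \<and> t - s \<noteq> - b"
  shows "splits S (poly_module.span {w})"
proof -
  define d where "d = degree p"
  define e where "e i = (T ^^ i) w" for i
  have reduce: "\<exists>r. act q w = act r w \<and> (degree r < d \<or> r = 0)" for q
  proof (intro exI conjI)
    have "act q w = act (q div p * p + q mod p) w" by simp
    also have "\<dots> = act (q mod p) w" by (simp only: act_add_left act_mult p) simp
    finally show "act q w = act (q mod p) w" .
    show "degree (q mod p) < d \<or> q mod p = 0" using degree_mod_less'[of p q] p d_def by blast
  qed
  show ?thesis
  proof (cases "d = 0")
    \<comment> \<open>Now \<open>p\<close> is a nonzero constant, so \<open>w = 0\<close>.\<close>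
    case True
    hence "act q w = 0" for q using reduce[of q] by auto
    from this[of 1] show ?thesis by (simp add: splits_zero poly_module.span_singleton)
  next
    case False
    hence d: "d > 0" by simp
    have expand: "\<exists>c. act q w = (\<Sum>i<d. c i *s e i)" for q
    proof -
      obtain r where "act q w = act r w" "degree r < d \<or> r = 0" using reduce by blast
      moreover from this(2) have "degree r < d" using d by auto
      ultimately show ?thesis using act_sum_degree[of r d w] unfolding e_def by metis
    qed
    have zero: "c i = 0" if c: "(\<Sum>i<d. c i *s e i) = 0" and i: "i < d" for c i
    proof -
      define r where "r = (\<Sum>i<d. Polynomial.monom (c i) i)"
      have cr: "coeff r i = (if i < d then c i else 0)" for i by (simp add: r_def coeff_sum)
      have "degree r \<le> d - 1" by (rule degree_le) (use d in \<open>auto simp: cr\<close>)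
      hence dr: "degree r < d" using d by simp
      have "act r w = (\<Sum>i<d. coeff r i *s e i)" unfolding e_def by (rule act_sum_degree[OF dr])
      also have "\<dots> = (\<Sum>i<d. c i *s e i)" by (rule sum.cong) (auto simp: cr)
      finally have "r = 0" using c min[of r] dr by (auto simp: d_def)
      with cr[of i] i show ?thesis by simp
    qed
    have inj: "inj_on e {..<d}"
    proof (rule inj_onI, rule ccontr)
      fix i j assume ij: "i \<in> {..<d}" "j \<in> {..<d}" "e i = e j" "i \<noteq> j"
      \<comment> \<open>Equality of \<open>e i\<close> and \<open>e j\<close> would be a relation
        with coefficient 1 at \<open>i\<close> and -1 at \<open>j\<close>.\<close>
      have "(\<Sum>k<d. (of_bool (k = i) - of_bool (k = j)) *s e k) =
          (\<Sum>k<d. if k = i then e k else 0) - (\<Sum>k<d. if k = j then e k else 0)"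
        unfolding sum_subtractf[symmetric] by (rule sum.cong) (auto simp: ij)
      also have "\<dots> = 0" using ij by simp
      finally show False using zero[of "\<lambda>k. of_bool (k = i) - of_bool (k = j)" i] ij by simp
    qed
    have indep: "independent (e ` {..<d})"
    proof (rule independent_if_scalars_zero)
      fix f x assume fx: "(\<Sum>x\<in>e ` {..<d}. f x *s x) = 0" "x \<in> e ` {..<d}"
      then obtain i where "i < d" "x = e i" by auto
      thus "f x = 0" using fx(1) zero[of "f \<circ> e" i] by (simp add: sum.reindex[OF inj])
    qed simp
    have U: "poly_module.span {w} = span (e ` {..<d})"
    proof
      show "poly_module.span {w} \<subseteq> span (e ` {..<d})"
      proof
        fix x assume "x \<in> poly_module.span {w}"
        then obtain q where "x = act q w" by (auto simp: poly_module.span_singleton)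
        moreover obtain c where "act q w = (\<Sum>i<d. c i *s e i)" using expand by blast
        ultimately have "x = (\<Sum>i<d. c i *s e i)" by simp
        thus "x \<in> span (e ` {..<d})"
          by (simp, intro span_sum span_scale) (simp add: span_base)
      qed
      have "e i \<in> poly_module.span {w}" for i
        using act_monom[of 1 i w]
        by (auto simp: poly_module.span_singleton e_def image_iff
            intro!: exI[of _ "Polynomial.monom 1 i"])
      thus "span (e ` {..<d}) \<subseteq> poly_module.span {w}"
        by (intro span_minimal subspace_if_poly_subspace) auto
    qed
    obtain c where "act (Polynomial.monom 1 d) w = (\<Sum>i<d. c i *s e i)" using expand by blast
    hence c: "T (e (d - 1)) = (\<Sum>i<d. c i *s e i)"
      using d by (cases d) (simp_all add: act_monom e_def)
    obtain a b s where abs: "{a, b, s, - a, - b, c (d - 1) - s} \<subseteq> S" "a \<noteq> b" "a \<noteq> s"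
      "c (d - 1) - s \<noteq> - a" "c (d - 1) - s \<noteq> - b" using S[of "c (d - 1)"] by blast
    show ?thesis unfolding U
      by (rule splits_companion[OF inj indep d _ c abs]) (simp add: e_def)
  qed
qed

lemma splits_torsion:
  assumes "finite I" "\<And>x. \<exists>p. p \<noteq> 0 \<and> act p x = 0"
    and "\<And>t. \<exists>a b s. {a, b, s, - a, - b, t - s} \<subseteq> S \<and> a \<noteq> b \<and> a \<noteq> s \<and> t - s \<noteq> - a \<and> t - s \<noteq> - b"
  shows "splits S (poly_module.span (v ` I))"
  by (rule splits_finitely_generated[OF assms(1,2)]) (rule splits_cyclic[OF _ _ _ assms(3)])

end

section \<open>Choice of the eigenvalues\<close>

lemma exists_not_in:
  assumes "finite X" "card X < CARD('a)"
  shows "\<exists>s::'a. s \<notin> X"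
proof (rule ccontr)
  assume "\<not> ?thesis"
  hence "X = UNIV" by auto
  thus False using assms(2) by simp
qed

text \<open>The element \<open>s\<close> has to avoid \<open>a\<close>, \<open>t + a\<close> and
  \<open>t + b\<close>. With possibly only three elements available, \<open>a\<close> and
  \<open>b\<close> are chosen so that two of these coincide: \<open>t + a = a\<close> if
  \<open>t = 0\<close>, and \<open>t + b = a\<close> otherwise.\<close>

lemma splitting_eigenvalues:
  assumes "CARD('a::{field, finite}) \<ge> 3"
  shows "\<exists>a b s :: 'a. a \<noteq> b \<and> a \<noteq> s \<and> t - s \<noteq> - a \<and> t - s \<noteq> - b"
proof (cases "t = 0")
  case True
  obtain b :: 'a where "b \<notin> {0}" using exists_not_in[of "{0 :: 'a}"] assms by auto
  moreover have "card {0, b} < CARD('a)" using assms card_insert_le_m1[of 2 "{b}" 0] by simp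
  then obtain s where "s \<notin> {0, b}" using exists_not_in[of "{0, b}"] by auto
  ultimately show ?thesis using True by (intro exI[of _ 0] exI[of _ b] exI[of _ s]) auto
next
  case False
  have "card {0, t} < CARD('a)" using assms False by simp
  then obtain s where "s \<notin> {0, t}" using exists_not_in[of "{0, t}"] by auto
  thus ?thesis using False by (intro exI[of _ 0] exI[of _ "- t"] exI[of _ s]) auto
qed

text \<open>Now \<open>s\<close> must avoid \<open>0\<close>, \<open>t\<close>, \<open>a\<close>,
  \<open>t + a\<close> and \<open>t + b\<close>. In each case \<open>a\<close> and \<open>b\<close>
  make these collapse to three values: for \<open>t = 0\<close> automatically, for
  \<open>t + t \<noteq> 0\<close> with \<open>a = t\<close> and \<open>b = - t\<close>, and for
  \<open>t + t = 0\<close> with \<open>a = t\<close>.\<close>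

lemma nonzero_splitting_eigenvalues:
  assumes "CARD('a::{field, finite}) \<ge> 4"
  shows "\<exists>a b s :: 'a. {a, b, s, - a, - b, t - s} \<subseteq> - {0} \<and>
    a \<noteq> b \<and> a \<noteq> s \<and> t - s \<noteq> - a \<and> t - s \<noteq> - b"
proof -
  have card3: "\<exists>s. s \<notin> {x, y, z}" for x y z :: 'a
    using assms by (intro exists_not_in) (simp_all add: card_insert_if)
  consider "t = 0" | "t \<noteq> 0" "t + t \<noteq> 0" | "t \<noteq> 0" "t + t = 0" by blast
  thus ?thesis
  proof cases
    case 1
    obtain a where "a \<notin> {0, 0, 0 :: 'a}" using card3 by blast
    moreover obtain b where "b \<notin> {0, 0, a}" using card3 by blast
    moreover obtain s where "s \<notin> {0, a, b}" using card3 by blast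
    ultimately show ?thesis using 1 by (intro exI[of _ a] exI[of _ b] exI[of _ s]) auto
  next
    case 2
    obtain s where s: "s \<notin> {0, t, t + t}" using card3 by blast
    have "t \<noteq> - t" using 2 by (metis ab_left_minus)
    moreover have "t - s \<noteq> - t" using s by (auto simp: algebra_simps)
    ultimately show ?thesis using 2 s by (intro exI[of _ t] exI[of _ "- t"] exI[of _ s]) auto
  next
    case 3
    obtain b where b: "b \<notin> {0, t, t}" using card3 by blast
    obtain s where s: "s \<notin> {0, t, t + b}" using card3 by blast
    have "t - s \<noteq> - t" using s 3 by (auto simp: algebra_simps)
    moreover have "t - s \<noteq> - b" using s by (auto simp: algebra_simps)
    ultimately show ?thesis using 3 s b by (intro exI[of _ t] exI[of _ b] exI[of _ s]) auto
  qed
qed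

section \<open>Powers of matrices\<close>

lemma pow_mat_add:
  assumes "A \<in> carrier_mat n n"
  shows "A ^\<^sub>m (r + s) = A ^\<^sub>m r * A ^\<^sub>m s"
proof (induction s)
  case (Suc s)
  have "A ^\<^sub>m (r + Suc s) = A ^\<^sub>m r * A ^\<^sub>m s * A" using Suc by simp
  also have "\<dots> = A ^\<^sub>m r * (A ^\<^sub>m s * A)"
    by (rule assoc_mult_mat) (use assms in auto)
  finally show ?case by simp
qed (use assms in simp)

lemma pow_mat_mult:
  assumes "A \<in> carrier_mat n n"
  shows "A ^\<^sub>m (r * s) = (A ^\<^sub>m r) ^\<^sub>m s"
proof (induction s)
  case (Suc s)
  have "A ^\<^sub>m (r * Suc s) = A ^\<^sub>m (r * s + r)" by (simp add: add.commute)
  thus ?case using Suc by (simp add: pow_mat_add[OF assms])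
qed (use assms in simp)

lemma pow_one_mat: "1\<^sub>m n ^\<^sub>m r = (1\<^sub>m n :: 'a::semiring_1 mat)"
  by (induction r) simp_all

lemma pow_transpose_mat:
  fixes A :: "'a::comm_semiring_1 mat"
  assumes "A \<in> carrier_mat n n"
  shows "transpose_mat A ^\<^sub>m r = transpose_mat (A ^\<^sub>m r)"
proof (induction r)
  case (Suc r)
  have "A ^\<^sub>m Suc r = A ^\<^sub>m (1 + r)" by simp
  also have "\<dots> = A * A ^\<^sub>m r" unfolding pow_mat_add[OF assms] using assms by simp
  finally have "transpose_mat (A ^\<^sub>m Suc r) = transpose_mat (A ^\<^sub>m r) * transpose_mat A"
    using transpose_mult[of A n n "A ^\<^sub>m r" n] assms by simp
  thus ?case using Suc by simp
qed (use assms in simp)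

lemma pow_mat_periodic:
  assumes A: "A \<in> carrier_mat n n" and "A ^\<^sub>m Suc N = A"
  shows "A ^\<^sub>m (N * y + 1) = A"
proof (induction y)
  case (Suc y)
  have "A ^\<^sub>m (N * Suc y + 1) = A ^\<^sub>m (N + (N * y + 1))" by (simp add: algebra_simps)
  also have "\<dots> = A ^\<^sub>m N * A" using pow_mat_add[OF A, of N "N * y + 1"] Suc by simp
  finally show ?case using assms by simp
qed (use A in simp)

lemma invertible_mat_if_pow_eq_one:
  assumes "A \<in> carrier_mat n n" "N > 0" "A ^\<^sub>m N = 1\<^sub>m n"
  shows "invertible_mat A"
proof -
  have N: "N = (N - 1) + 1" "N = 1 + (N - 1)" using assms(2) by auto
  have "A ^\<^sub>m N = A ^\<^sub>m (N - 1) * A" "A ^\<^sub>m N = A * A ^\<^sub>m (N - 1)"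
    using pow_mat_add[OF assms(1), of "N - 1" 1] pow_mat_add[OF assms(1), of 1 "N - 1"] N assms(1)
    by simp_all
  thus ?thesis using assms unfolding invertible_mat_def inverts_mat_def
    by (metis carrier_matD pow_mat_dim_square(1) square_mat.simps)
qed

text \<open>An exponent inverse to \<open>k\<close> modulo the period \<open>N\<close> yields the
  root. Periodicity is assumed only from the first power on, which admits singular matrices.\<close>

lemma pow_mat_root:
  assumes A: "A \<in> carrier_mat n n" "A ^\<^sub>m Suc N = A" and k: "k \<ge> 1" "gcd k N = 1"
  obtains m where "(A ^\<^sub>m m) ^\<^sub>m k = A"
proof -
  obtain x y where "k * x = N * y + 1" using bezout_nat[of k N] k by auto
  hence "(A ^\<^sub>m x) ^\<^sub>m k = A"
    using pow_mat_mult[OF A(1), of x k] pow_mat_periodic[OF A, of y] by (simp add: mult.commute)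
  thus thesis by (rule that)
qed

lemma pow_mat_commute_pow:
  assumes "A \<in> carrier_mat n n"
  shows "(A ^\<^sub>m r) ^\<^sub>m s = (A ^\<^sub>m s) ^\<^sub>m r"
  using pow_mat_mult[OF assms] by (metis mult.commute)

section \<open>Split semisimple matrices over a finite field\<close>

text \<open>Induction on \<open>C\<close>: if \<open>c\<close> is a root of \<open>f\<close>, its
  linear factor is removed from \<open>f\<close>; otherwise it is a root of the cofactor, and the
  linear factor cancels there.\<close>

lemma monic_dvd_prod_linear:
  fixes f :: "'a::field poly"
  assumes "finite C" "lead_coeff f = 1" "f dvd (\<Prod>c\<in>C. [:- c, 1:])"
  obtains D where "D \<subseteq> C" "f = (\<Prod>c\<in>D. [:- c, 1:])"
  using assms
proof (induction C arbitrary: f thesis rule: finite_induct)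
  case empty
  hence "f = 1" by (intro monic_dvd_antisym) auto
  thus ?case using empty(1)[of "{}"] by simp
next
  case (insert c C)
  have dvd: "f dvd [:- c, 1:] * (\<Prod>c\<in>C. [:- c, 1:])"
    using insert.prems(3) prod.insert[OF insert.hyps, of "\<lambda>c. [:- c, 1:]"] by metis
  show ?case
  proof (cases "poly f c = 0")
    case True
    then obtain g where g: "f = [:- c, 1:] * g" by (auto simp: poly_eq_0_iff_dvd elim: dvdE)
    have "[:- c, 1:] * g dvd [:- c, 1:] * (\<Prod>c\<in>C. [:- c, 1:])"
      using dvd unfolding g .
    hence "g dvd (\<Prod>c\<in>C. [:- c, 1:])" by (simp only: dvd_mult_cancel_left) simp
    moreover have "lead_coeff f = lead_coeff [:- c, 1:] * lead_coeff g"
      unfolding g by (rule lead_coeff_mult)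
    hence "lead_coeff g = 1" using insert.prems(2) by simp
    ultimately obtain D where D: "D \<subseteq> C" "g = (\<Prod>c\<in>D. [:- c, 1:])" using insert.IH by metis
    have "finite D" "c \<notin> D" using D(1) insert.hyps by (auto intro: finite_subset)
    hence "f = (\<Prod>c\<in>insert c D. [:- c, 1:])" unfolding g D(2) by (rule prod.insert[symmetric])
    thus ?thesis using insert.prems(1)[of "insert c D"] D(1) by blast
  next
    case False
    obtain g where g: "[:- c, 1:] * (\<Prod>c\<in>C. [:- c, 1:]) = f * g"
      using dvd by (rule dvdE)
    have "poly (f * g) c = 0" unfolding g[symmetric] by simp
    hence "poly g c = 0" using False by simp
    then obtain h where "g = [:- c, 1:] * h" by (auto simp: poly_eq_0_iff_dvd elim: dvdE)
    hence "[:- c, 1:] * (\<Prod>c\<in>C. [:- c, 1:]) = [:- c, 1:] * (f * h)"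
      unfolding g by (simp only: mult.left_commute)
    hence "(\<Prod>c\<in>C. [:- c, 1:]) = f * h" by (simp only: mult_cancel_left) simp
    hence "f dvd (\<Prod>c\<in>C. [:- c, 1:])" by simp
    then obtain D where "D \<subseteq> C" "f = (\<Prod>c\<in>D. [:- c, 1:])"
      using insert.IH insert.prems(2) by metis
    thus ?thesis using insert.prems(1)[of D] by blast
  qed
qed

text \<open>Multiplication by \<open>x\<close> permutes the nonzero elements, so it preserves their
  product.\<close>

lemma power_card_minus_1_eq_1:
  fixes x :: "'a::{field, finite}"
  assumes "x \<noteq> 0"
  shows "x ^ (CARD('a) - 1) = 1"
proof -
  have "(\<Prod>y\<in>UNIV - {0}. x * y) = (\<Prod>y\<in>UNIV - {0}. y)"
    by (rule prod.reindex_bij_witness[of _ "\<lambda>y. y / x" "\<lambda>y. x * y"]) (use assms in auto)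
  hence "x ^ (CARD('a) - 1) * (\<Prod>y\<in>UNIV - {0 :: 'a}. y) = (\<Prod>y\<in>UNIV - {0}. y)"
    by (simp add: prod.distrib card_Diff_singleton)
  thus ?thesis by simp
qed

lemma power_card_eq_same: "(x :: 'a::{field, finite}) ^ CARD('a) = x"
proof -
  have "CARD('a) = Suc (CARD('a) - 1)" using finite_UNIV_card_ge_0[where 'a = 'a] by simp
  thus ?thesis using power_card_minus_1_eq_1[of x]
    by (cases "x = 0") (metis power_0_Suc, metis power_Suc mult_1_right)
qed

text \<open>Both sides are monic of degree \<open>CARD('a)\<close> and vanish at every element of
  the field.\<close>

lemma prod_all_linear:
  "(\<Prod>c\<in>UNIV. [:- c, 1:]) = (Polynomial.monom 1 CARD('a) - Polynomial.monom 1 1 :: 'a::{field, finite} poly)"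
    (is "?P = ?Q")
proof (rule poly_eqI_degree_lead_coeff[where n = "CARD('a)" and A = UNIV])
  have q: "CARD('a) > 1" 
    using card_mono[of UNIV "{0, 1::'a}"] by simp
  have dP: "degree ?P = CARD('a)" by (simp add: degree_prod_eq_sum_degree)
  show "degree ?P \<le> CARD('a)" using dP by simp
  show "degree ?Q \<le> CARD('a)" using q by (intro degree_diff_le) (simp_all add: degree_monom_eq)
  have "lead_coeff ?P = 1" by (simp add: lead_coeff_prod)
  thus "coeff ?P CARD('a) = coeff ?Q CARD('a)" using q dP by simp
  show "poly ?P z = poly ?Q z" for z
    using power_card_eq_same[of z]
    by (auto simp: poly_prod poly_monom intro!: prod_zero)
qed simp

text \<open>The minimal polynomial divides \<open>x^q - x\<close>, the product of all monic linear
  polynomials, each occurring once.\<close>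

lemma split_semisimple_if_pow_card:
  fixes A :: "'a::{field, finite} mat"
  assumes A: "A \<in> carrier_mat n n" and pow: "A ^\<^sub>m CARD('a) = A"
  shows "split_semisimple A"
proof -
  let ?f = "Polynomial.monom 1 CARD('a) - Polynomial.monom 1 1 :: 'a poly"
  have q: "CARD('a) > 1" using card_mono[of UNIV "{0, 1::'a}"] by simp
  have deg: "degree ?f \<le> CARD('a)" using q by (intro degree_diff_le) (simp_all add: degree_monom_eq)
  have "(\<Sum>r\<le>CARD('a). coeff ?f r * (A ^\<^sub>m r) $$ (i, j)) = 0" if "i < n" "j < n" for i j
  proof -
    have "(\<Sum>r\<le>CARD('a). coeff ?f r * (A ^\<^sub>m r) $$ (i, j)) =
        (\<Sum>r\<le>CARD('a). (if r = CARD('a) then (A ^\<^sub>m r) $$ (i, j) else 0) -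
          (if r = 1 then (A ^\<^sub>m r) $$ (i, j) else 0))"
      by (rule sum.cong) auto
    also have "\<dots> = (A ^\<^sub>m CARD('a)) $$ (i, j) - (A ^\<^sub>m 1) $$ (i, j)"
      unfolding sum_subtractf using q by simp
    finally show ?thesis using pow A by simp
  qed
  hence "min_poly A dvd ?f"
    using min_poly(2)[OF A] poly_eval_mat_eq_0_iff[OF A deg] by blast
  then obtain D where D: "min_poly A = (\<Prod>c\<in>D. [:- c, 1:])"
    using monic_dvd_prod_linear[of UNIV "min_poly A"] min_poly(1)[OF A] prod_all_linear[where 'a = 'a]
    by auto
  have "inj_on (\<lambda>c :: 'a. [:- c, 1:]) D" by (auto simp: inj_on_def)
  hence "min_poly A = \<Prod>((\<lambda>c. [:- c, 1:]) ` D)" using D by (simp add: prod.reindex)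
  thus ?thesis unfolding split_semisimple_def
    by (intro exI[of _ "(\<lambda>c. [:- c, 1:]) ` D"]) auto
qed

section \<open>Unipotent matrices\<close>

text \<open>Level 1 is upper unitriangular; level \<open>d\<close> has its first
  \<open>d - 1\<close> superdiagonals zero; from \<open>d = n\<close> on only the identity is
  left.\<close>

definition unipotent_level :: "nat \<Rightarrow> nat \<Rightarrow> 'a::semiring_1 mat \<Rightarrow> bool" where
  "unipotent_level n d X \<longleftrightarrow> X \<in> carrier_mat n n \<and>
     (\<forall>i<n. \<forall>j<n. j < i + d \<longrightarrow> X $$ (i, j) = of_bool (i = j))"

text \<open>The first free superdiagonal is additive: in the sum for the entry
  \<open>(i, i + d)\<close> only the terms \<open>k = i\<close> and \<open>k = i + d\<close>
  survive.\<close>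

lemma unipotent_level_mult:
  fixes X Y :: "'a::comm_ring_1 mat"
  assumes X: "unipotent_level n d X" and Y: "unipotent_level n d Y" and d: "d > 0"
  shows "unipotent_level n d (X * Y)"
    and "\<And>i. i + d < n \<Longrightarrow> (X * Y) $$ (i, i + d) = X $$ (i, i + d) + Y $$ (i, i + d)"
proof -
  have entry: "(X * Y) $$ (i, j) = (\<Sum>k<n. X $$ (i, k) * Y $$ (k, j))" if "i < n" "j < n" for i j
    using that X Y by (auto simp: unipotent_level_def scalar_prod_def atLeast0LessThan)
  have Xe: "X $$ (i, j) = of_bool (i = j)" if "i < n" "j < n" "j < i + d" for i j
    using that X by (auto simp: unipotent_level_def)
  have Ye: "Y $$ (i, j) = of_bool (i = j)" if "i < n" "j < n" "j < i + d" for i j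
    using that Y by (auto simp: unipotent_level_def)
  have "(X * Y) $$ (i, j) = of_bool (i = j)" if ij: "i < n" "j < n" "j < i + d" for i j
  proof -
    have "X $$ (i, k) * Y $$ (k, j) = (if k = i then of_bool (i = j) else 0)" if "k < n" for k
      using Xe[OF ij(1) that] Ye[OF that ij(2)] Ye[OF ij] ij by (cases "k < i + d") auto
    thus ?thesis using ij by (simp add: entry)
  qed
  thus "unipotent_level n d (X * Y)" using X Y by (auto simp: unipotent_level_def)
  fix i assume i: "i + d < n"
  have "X $$ (i, k) * Y $$ (k, i + d) =
      (if k = i then Y $$ (i, i + d) else 0) + (if k = i + d then X $$ (i, i + d) else 0)" if "k < n" for k
    using Xe[OF _ that, of i] Ye[OF that i] Xe[of i i] Ye[of "i + d" "i + d"] i d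
    by (cases "k < i + d"; cases "k = i + d") auto
  thus "(X * Y) $$ (i, i + d) = X $$ (i, i + d) + Y $$ (i, i + d)"
    using i by (simp add: entry sum.distrib)
qed

lemma unipotent_level_cube:
  fixes X :: "'a::comm_ring_1 mat"
  assumes X: "unipotent_level n d X" and d: "d > 0" and char3: "(3 :: 'a) = 0"
  shows "unipotent_level n (Suc d) (X ^\<^sub>m 3)"
proof -
  have Xc: "X \<in> carrier_mat n n" using X by (simp add: unipotent_level_def)
  have cube: "X ^\<^sub>m 3 = X * X * X" using Xc by (simp add: eval_nat_numeral)
  note XX = unipotent_level_mult[OF X X d]
  note XXX = unipotent_level_mult[OF XX(1) X d]
  have "(X * X * X) $$ (i, i + d) = 0" if "i + d < n" for i
  proof -
    have "(X * X * X) $$ (i, i + d) = 3 * X $$ (i, i + d)"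
      using XX(2)[OF that] XXX(2)[OF that] by (simp add: algebra_simps)
    thus ?thesis using char3 by simp
  qed
  moreover have "j < i + Suc d \<longleftrightarrow> j < i + d \<or> j = i + d" for i j by auto
  ultimately show ?thesis unfolding cube
    using XXX(1) d unfolding unipotent_level_def by auto
qed

text \<open>Each cubing raises the level by one, and \<open>n\<close> cubings reach level
  \<open>Suc n\<close>.\<close>

lemma unipotent_pow_eq_one:
  fixes X :: "'a::comm_ring_1 mat"
  assumes X: "unipotent_level n 1 X" and char3: "(3 :: 'a) = 0"
  shows "X ^\<^sub>m (3 ^ n) = 1\<^sub>m n"
proof -
  have Xc: "X \<in> carrier_mat n n" using X by (simp add: unipotent_level_def)
  have "unipotent_level n (Suc s) (X ^\<^sub>m (3 ^ s))" for s
  proof (induction s)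
    case 0
    thus ?case using X Xc by simp
  next
    case (Suc s)
    have "X ^\<^sub>m (3 ^ Suc s) = (X ^\<^sub>m (3 ^ s)) ^\<^sub>m 3"
      using pow_mat_mult[OF Xc, of "3 ^ s" 3] by (simp add: mult.commute)
    thus ?case using unipotent_level_cube[OF Suc _ char3] by simp
  qed
  from this[of n] show ?thesis by (intro eq_matI) (auto simp: unipotent_level_def)
qed

text \<open>The order of \<open>A\<close> divides \<open>2 * 3 ^ n\<close>, so a \<open>k\<close>-th
  root can be found among the powers of \<open>A\<close>; being such a power, it has finite order
  and is invertible.\<close>

lemma triangular_root_char3:
  fixes A :: "'a::comm_ring_1 mat"
  assumes A: "A \<in> carrier_mat n n" and char3: "(3 :: 'a) = 0"
    and upper: "\<And>i j. i < n \<Longrightarrow> j < i \<Longrightarrow> A $$ (i, j) = 0"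
    and diag: "\<And>i. i < n \<Longrightarrow> A $$ (i, i) * A $$ (i, i) = 1"
    and k: "k \<ge> 1" "gcd k 2 = 1" "\<not> 3 dvd k"
  obtains B where "B \<in> carrier_mat n n" "invertible_mat B" "B ^\<^sub>m k = A"
proof -
  have "(A * A) $$ (i, j) = of_bool (i = j)" if ij: "i < n" "j < n" "j < i + 1" for i j
  proof -
    have "(A * A) $$ (i, j) = (\<Sum>k<n. A $$ (i, k) * A $$ (k, j))"
      using ij A by (auto simp: scalar_prod_def atLeast0LessThan)
    also have "\<dots> = (\<Sum>k<n. if k = i then of_bool (i = j) else 0)"
    proof (rule sum.cong)
      fix k assume "k \<in> {..<n}"
      thus "A $$ (i, k) * A $$ (k, j) = (if k = i then of_bool (i = j) else 0)"
        using upper[of i k] upper[of k j] upper[of i j] diag[of i] ij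
        by (cases "k < i"; cases "k = i"; cases "i = j") auto
    qed simp
    finally show ?thesis using ij by simp
  qed
  hence "unipotent_level n 1 (A * A)" using A by (auto simp: unipotent_level_def)
  hence "(A * A) ^\<^sub>m (3 ^ n) = 1\<^sub>m n" using char3 by (rule unipotent_pow_eq_one)
  moreover have "A * A = A ^\<^sub>m 2" using A by (simp add: numeral_2_eq_2)
  ultimately have one: "A ^\<^sub>m (2 * 3 ^ n) = 1\<^sub>m n" using pow_mat_mult[OF A] by simp
  have "coprime k 3" using k(3) prime_imp_coprime[of 3 k] by (simp add: coprime_commute)
  moreover have "coprime k 2" using k(2) by (simp only: coprime_iff_gcd_eq_1)
  ultimately have "coprime k (2 * 3 ^ n)"
    by (simp only: coprime_mult_right_iff coprime_power_right_iff) simp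
  moreover have "A ^\<^sub>m Suc (2 * 3 ^ n) = A" using one A by simp
  ultimately obtain m where m: "(A ^\<^sub>m m) ^\<^sub>m k = A"
    using pow_mat_root[OF A _ k(1), of "2 * 3 ^ n"] by auto
  have "(A ^\<^sub>m m) ^\<^sub>m (2 * 3 ^ n) = 1\<^sub>m n"
    using pow_mat_commute_pow[OF A, of m "2 * 3 ^ n"] one pow_one_mat by simp
  hence "invertible_mat (A ^\<^sub>m m)" using A by (intro invertible_mat_if_pow_eq_one) auto
  thus thesis using that[of "A ^\<^sub>m m"] m A by simp
qed

section \<open>Matrices as operators on finitely supported functions\<close>

text \<open>The operator results concern a vector space that fills a type, while \<open>n\<close> is
  a variable. Vectors of length \<open>n\<close> are therefore functions on \<open>nat\<close> that
  vanish from \<open>n\<close> on, inside the space of all functions.\<close>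

definition vscale :: "'a::field \<Rightarrow> (nat \<Rightarrow> 'a) \<Rightarrow> nat \<Rightarrow> 'a" where
  "vscale c f = (\<lambda>i. c * f i)"

lemma vscale_apply: "vscale c f i = c * f i"
  by (simp add: vscale_def)

definition unit_fun :: "nat \<Rightarrow> nat \<Rightarrow> 'a::field" where
  "unit_fun j = (\<lambda>i. of_bool (i = j))"

definition coord_space :: "nat \<Rightarrow> (nat \<Rightarrow> 'a::field) set" where
  "coord_space n = {f. \<forall>i\<ge>n. f i = 0}"

text \<open>Values at indices from \<open>n\<close> on are set to 0, so the operator maps every
  function into the finite-dimensional \<open>coord_space n\<close>.\<close>

definition mat_operator :: "nat \<Rightarrow> 'a::field mat \<Rightarrow> (nat \<Rightarrow> 'a) \<Rightarrow> nat \<Rightarrow> 'a" where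
  "mat_operator n M f = (\<lambda>i. if i < n then \<Sum>j<n. M $$ (i, j) * f j else 0)"

definition operator_mat :: "nat \<Rightarrow> ((nat \<Rightarrow> 'a::field) \<Rightarrow> nat \<Rightarrow> 'a) \<Rightarrow> 'a mat" where
  "operator_mat n A = mat n n (\<lambda>(i, j). A (unit_fun j) i)"

lemma operator_mat_carrier [simp]: "operator_mat n A \<in> carrier_mat n n"
  by (simp add: operator_mat_def)

interpretation vscale: vector_space vscale
  by unfold_locales (auto simp: vscale_apply fun_eq_iff algebra_simps)

lemma sum_fun_apply: "(\<Sum>j\<in>J. g j) i = (\<Sum>j\<in>J. g j i)"
  for g :: "'b \<Rightarrow> 'c \<Rightarrow> 'd::comm_monoid_add"
  by (induction J rule: infinite_finite_induct) auto

lemma linear_operator_mat_operator: "linear_operator vscale (mat_operator n M)"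
proof (intro linear_operator.intro linear_operator_axioms.intro vscale.vector_space_axioms)
  show "Vector_Spaces.linear vscale vscale (mat_operator n M)"
    unfolding Vector_Spaces.linear_iff
    by (auto simp: vscale.vector_space_axioms mat_operator_def vscale_apply fun_eq_iff
        sum_distrib_left sum.distrib algebra_simps)
qed

lemma coord_space_expansion:
  assumes "f \<in> coord_space n"
  shows "f = (\<Sum>j<n. vscale (f j) (unit_fun j))"
proof
  fix i
  have "(\<Sum>j<n. vscale (f j) (unit_fun j)) i = (\<Sum>j<n. if j = i then f i else 0)"
    unfolding sum_fun_apply by (rule sum.cong) (auto simp: vscale_apply unit_fun_def)
  thus "f i = (\<Sum>j<n. vscale (f j) (unit_fun j)) i"
    using assms by (auto simp: coord_space_def)
qed

lemma operator_mat_mult_vec: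
  assumes A: "Vector_Spaces.linear vscale vscale A" and f: "f \<in> coord_space n"
  shows "operator_mat n A *\<^sub>v vec n f = vec n (A f)"
proof -
  interpret A: Vector_Spaces.linear vscale vscale A by (rule A)
  have "A f = (\<Sum>j<n. vscale (f j) (A (unit_fun j)))"
    by (subst coord_space_expansion[OF f]) (simp add: A.sum A.scale)
  hence "A f i = (\<Sum>j<n. f j * A (unit_fun j) i)" for i
    by (simp add: sum_fun_apply vscale_apply)
  thus ?thesis
    by (intro eq_vecI) (auto simp: operator_mat_def scalar_prod_def atLeast0LessThan mult.commute)
qed

lemma mat_eqI_mult_vec:
  fixes A B :: "'a::field mat"
  assumes A: "A \<in> carrier_mat n n" and B: "B \<in> carrier_mat n n"
    and eq: "\<And>f. f \<in> coord_space n \<Longrightarrow> A *\<^sub>v vec n f = B *\<^sub>v vec n f"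
  shows "A = B"
proof (rule eq_matI)
  fix i j assume "i < dim_row B" "j < dim_col B"
  hence ij: "i < n" "j < n" using B by auto
  have u: "vec n (unit_fun j) = (unit_vec n j :: 'a vec)" 
    by (rule eq_vecI) (auto simp: unit_fun_def unit_vec_def)
  have "unit_fun j \<in> (coord_space n :: (nat \<Rightarrow> 'a) set)"
    using ij by (auto simp: coord_space_def unit_fun_def)
  from eq[OF this] have "(A *\<^sub>v unit_vec n j) $ i = (B *\<^sub>v unit_vec n j) $ i" unfolding u by simp
  thus "A $$ (i, j) = B $$ (i, j)" using A B ij by simp
qed (use A B in auto)

text \<open>The \<open>r\<close>-th power multiplies an eigenvector by \<open>c ^ r\<close>, and the
  eigenvectors span; an identity between powers of the eigenvalues thus passes to the
  matrix.\<close>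

lemma operator_mat_pow_eq:
  assumes A: "Vector_Spaces.linear vscale vscale A"
    and span: "coord_space n \<subseteq> vscale.span {f \<in> coord_space n. \<exists>c\<in>S. A f = vscale c f}"
    and pow: "\<And>c. c \<in> S \<Longrightarrow> c ^ r = c ^ r'"
  shows "operator_mat n A ^\<^sub>m r = operator_mat n A ^\<^sub>m r'"
proof (rule mat_eqI_mult_vec[of _ n])
  let ?M = "operator_mat n A"
  have M: "?M ^\<^sub>m k \<in> carrier_mat n n" for k by simp
  have eig: "?M ^\<^sub>m k *\<^sub>v vec n f = c ^ k \<cdot>\<^sub>v vec n f" if f: "f \<in> coord_space n" "A f = vscale c f" for f c k
  proof (induction k)
    case (Suc k)
    have "?M ^\<^sub>m Suc k *\<^sub>v vec n f = ?M ^\<^sub>m k *\<^sub>v (?M *\<^sub>v vec n f)"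
      using assoc_mult_mat_vec[of "?M ^\<^sub>m k" n n ?M n "vec n f"] by simp
    also have "?M *\<^sub>v vec n f = c \<cdot>\<^sub>v vec n f"
      unfolding operator_mat_mult_vec[OF A f(1)] f(2) by (auto simp: vscale_apply)
    also have "?M ^\<^sub>m k *\<^sub>v (c \<cdot>\<^sub>v vec n f) = c \<cdot>\<^sub>v (?M ^\<^sub>m k *\<^sub>v vec n f)"
      by (rule mult_mat_vec[of _ n n]) simp_all
    finally show ?case unfolding Suc by (simp add: smult_smult_assoc)
  qed (simp add: operator_mat_def)
  fix f assume "f \<in> (coord_space n :: (nat \<Rightarrow> 'a) set)"
  hence "f \<in> vscale.span {f \<in> coord_space n. \<exists>c\<in>S. A f = vscale c f}" using span by blast
  thus "?M ^\<^sub>m r *\<^sub>v vec n f = ?M ^\<^sub>m r' *\<^sub>v vec n f"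
  proof (induction rule: vscale.span_induct_alt)
    case base
    have "vec n 0 = (0\<^sub>v n :: 'a vec)" by auto
    moreover have "?M ^\<^sub>m k *\<^sub>v 0\<^sub>v n = 0\<^sub>v n" for k
      by (rule eq_vecI) (auto simp: operator_mat_def scalar_prod_def)
    ultimately show ?case by metis
  next
    case (step c g h)
    have g: "?M ^\<^sub>m r *\<^sub>v vec n g = ?M ^\<^sub>m r' *\<^sub>v vec n g"
    proof -
      obtain b where b: "g \<in> coord_space n" "A g = vscale b g" "b \<in> S" using step.hyps by blast
      show ?thesis unfolding eig[OF b(1,2)] pow[OF b(3)] ..
    qed
    have "vec n (vscale c g + h) = c \<cdot>\<^sub>v vec n g + vec n h" by (auto simp: vscale_apply)
    moreover have "?M ^\<^sub>m k *\<^sub>v (c \<cdot>\<^sub>v vec n g + vec n h) =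
        c \<cdot>\<^sub>v (?M ^\<^sub>m k *\<^sub>v vec n g) + ?M ^\<^sub>m k *\<^sub>v vec n h" for k
      using mult_add_distrib_mat_vec[OF M, of "c \<cdot>\<^sub>v vec n g" "vec n h"]
        mult_mat_vec[OF M, of "vec n g"] by simp
    ultimately show ?case using g step.IH by metis
  qed
qed simp_all

text \<open>Diagonalizability with eigenvalues in \<open>S\<close> is recorded through power
  identities, from which \<open>A^q = A\<close> and, for nonzero eigenvalues,
  \<open>A^(q-1) = 1\<close> follow.\<close>

lemma mat_eq_sum_diagonalizable:
  fixes M :: "'a::{field, finite} mat" and S :: "'a set"
  assumes M: "M \<in> carrier_mat n n"
    and S: "\<And>t. \<exists>a b s. {a, b, s, - a, - b, t - s} \<subseteq> S \<and> a \<noteq> b \<and> a \<noteq> s \<and> t - s \<noteq> - a \<and> t - s \<noteq> - b"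
  obtains A B where "A \<in> carrier_mat n n" "B \<in> carrier_mat n n" "M = A + B"
    "\<And>r r'. (\<And>c. c \<in> S \<Longrightarrow> c ^ r = c ^ r') \<Longrightarrow> A ^\<^sub>m r = A ^\<^sub>m r'"
    "\<And>r r'. (\<And>c. c \<in> S \<Longrightarrow> c ^ r = c ^ r') \<Longrightarrow> B ^\<^sub>m r = B ^\<^sub>m r'"
proof -
  let ?T = "mat_operator n M" and ?U = "coord_space n :: (nat \<Rightarrow> 'a) set"
  interpret linear_operator vscale ?T by (rule linear_operator_mat_operator)
  interpret vp: vector_space_pair vscale vscale by unfold_locales
  have TU: "?T f \<in> ?U" for f by (auto simp: mat_operator_def coord_space_def)
  have fin: "finite ?U"
    using finite_set_of_finite_funs[of "{..<n}" "UNIV :: 'a set" 0]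
    by (rule finite_subset[rotated]) (auto simp: coord_space_def)
  \<comment> \<open>The orbit of \<open>x\<close> under \<open>T\<close> is finite, so two powers of \<open>T\<close> agree on \<open>x\<close>.\<close>
  have torsion: "\<exists>p. p \<noteq> 0 \<and> act p x = 0" for x
  proof -
    \<comment> \<open>The powers start at \<open>Suc i\<close> because \<open>x\<close> need not lie
      in \<open>?U\<close>, whereas every value of \<open>?T\<close> does.\<close>
    have "range (\<lambda>i. (?T ^^ Suc i) x) \<subseteq> ?U" using TU by auto
    hence "\<not> inj (\<lambda>i. (?T ^^ Suc i) x)" using fin finite_subset range_inj_infinite by blast
    then obtain i j where ij: "(?T ^^ Suc i) x = (?T ^^ Suc j) x" "i \<noteq> j" by (auto simp: inj_def)
    let ?p = "Polynomial.monom 1 (Suc i) + Polynomial.monom (- 1) (Suc j) :: 'a poly"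
    have "coeff ?p (Suc i) = 1" using ij(2) by simp
    hence "?p \<noteq> 0" by force
    moreover have "act ?p x = 0" using ij(1) by (simp add: act_add_left act_monom del: funpow.simps)
    ultimately show ?thesis by blast
  qed
  have "?U = poly_module.span (unit_fun ` {..<n})"
  proof
    show "?U \<subseteq> poly_module.span (unit_fun ` {..<n})"
    proof
      fix f assume "f \<in> ?U"
      hence "f = (\<Sum>j<n. act [:f j:] (unit_fun j))" unfolding act_const by (rule coord_space_expansion)
      moreover have "(\<Sum>j<n. act [:f j:] (unit_fun j)) \<in> poly_module.span (unit_fun ` {..<n})"
        by (rule poly_module.span_sum, rule poly_module.span_scale, rule poly_module.span_base) simp
      ultimately show "f \<in> poly_module.span (unit_fun ` {..<n})" by metis
    qed
    have "act p f \<in> ?U" if "f \<in> ?U" for p f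
    proof (induction p)
      case (pCons a p)
      have "vscale a f + ?T (act p f) \<in> ?U"
        using that TU[of "act p f"] by (simp add: coord_space_def vscale_apply)
      thus ?case by (simp only: act_pCons)
    qed (simp add: coord_space_def)
    hence "poly_module.subspace ?U"
      by (auto simp: poly_module.subspace_def) (auto simp: coord_space_def)
    thus "poly_module.span (unit_fun ` {..<n}) \<subseteq> ?U"
      by (rule poly_module.span_minimal[rotated]) (auto simp: coord_space_def unit_fun_def)
  qed
  hence "splits S ?U" using splits_torsion[OF finite_lessThan torsion S, of unit_fun n] by simp
  then obtain A where A: "Vector_Spaces.linear vscale vscale A"
    and eA: "?U \<subseteq> vscale.span (eigenvectors S A ?U)" "?U \<subseteq> vscale.span (eigenvectors S (\<lambda>x. ?T x - A x) ?U)"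
    unfolding splits_def by blast
  let ?B = "\<lambda>x. ?T x - A x"
  have B: "Vector_Spaces.linear vscale vscale ?B"
    by (rule vp.linear_compose_sub[OF linear_T A])
  have "?T (unit_fun j) i = M $$ (i, j)" if "i < n" "j < n" for i j
    using that by (simp add: mat_operator_def unit_fun_def)
  hence sum: "M = operator_mat n A + operator_mat n ?B"
    using M by (intro eq_matI) (auto simp: operator_mat_def)
  show thesis
  proof (rule that[OF operator_mat_carrier operator_mat_carrier sum])
    fix r r' assume pow: "\<And>c. c \<in> S \<Longrightarrow> c ^ r = c ^ r'"
    show "operator_mat n A ^\<^sub>m r = operator_mat n A ^\<^sub>m r'"
      by (rule operator_mat_pow_eq[OF A eA(1)[unfolded eigenvectors_def] pow])
    show "operator_mat n ?B ^\<^sub>m r = operator_mat n ?B ^\<^sub>m r'"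
      by (rule operator_mat_pow_eq[OF B eA(2)[unfolded eigenvectors_def] pow])
  qed
qed

section \<open>Sums of two powers\<close>

text \<open>The root is a power of \<open>A\<close>, so it inherits both \<open>A^q = A\<close> and,
  when available, \<open>A^(q-1) = 1\<close>.\<close>

lemma split_semisimple_root:
  fixes A :: "'a::{field, finite} mat"
  assumes A: "A \<in> carrier_mat n n" "A ^\<^sub>m CARD('a) = A" and k: "k \<ge> 1" "gcd k (CARD('a) - 1) = 1"
  obtains B where "B \<in> carrier_mat n n" "split_semisimple B" "B ^\<^sub>m k = A"
    "A ^\<^sub>m (CARD('a) - 1) = 1\<^sub>m n \<Longrightarrow> invertible_mat B"
proof -
  have q: "CARD('a) > 1" using card_mono[of UNIV "{0, 1::'a}"] by simp
  hence "A ^\<^sub>m Suc (CARD('a) - 1) = A" using A(2) by simp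
  then obtain m where m: "(A ^\<^sub>m m) ^\<^sub>m k = A" using pow_mat_root[OF A(1) _ k] by blast
  have commute: "(A ^\<^sub>m m) ^\<^sub>m r = (A ^\<^sub>m r) ^\<^sub>m m" for r by (rule pow_mat_commute_pow[OF A(1)])
  have "split_semisimple (A ^\<^sub>m m)"
    by (rule split_semisimple_if_pow_card[of _ n]) (use A commute in simp_all)
  moreover have "invertible_mat (A ^\<^sub>m m)" if "A ^\<^sub>m (CARD('a) - 1) = 1\<^sub>m n"
    using A(1) q commute[of "CARD('a) - 1"] that pow_one_mat[of n m]
    by (intro invertible_mat_if_pow_eq_one[of _ n "CARD('a) - 1"]) simp_all
  ultimately show thesis using that[of "A ^\<^sub>m m"] A(1) m by simp
qed

lemma invertible_mat_transpose:
  fixes A :: "'a::comm_semiring_1 mat"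
  assumes "invertible_mat A"
  shows "invertible_mat (transpose_mat A)"
proof -
  obtain B where B: "square_mat A" "A * B = 1\<^sub>m (dim_row A)" "B * A = 1\<^sub>m (dim_row B)"
    using assms by (auto simp: invertible_mat_def inverts_mat_def)
  define n where "n = dim_row A"
  have A: "A \<in> carrier_mat n n" using B(1) by (auto simp: n_def)
  have "dim_col (A * B) = n" "dim_col (B * A) = dim_row B" using B(2,3) by (simp_all add: n_def)
  hence Bc: "B \<in> carrier_mat n n" using A by auto
  have "transpose_mat A * transpose_mat B = 1\<^sub>m n" "transpose_mat B * transpose_mat A = 1\<^sub>m n"
    using B(2,3) A Bc by (simp_all flip: transpose_mult)
  thus ?thesis using A Bc by (auto simp: invertible_mat_def inverts_mat_def)
qed

lemma sum_invertible_powers_card_3: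
  fixes M :: "'a::{field, finite} mat"
  assumes q: "CARD('a) = 3" and k: "k \<ge> 1" "gcd k 2 = 1" "\<not> 3 dvd k" and M: "M \<in> carrier_mat n n"
  obtains A B where "A \<in> carrier_mat n n" "B \<in> carrier_mat n n" "invertible_mat A" "invertible_mat B"
    "M = A ^\<^sub>m k + B ^\<^sub>m k"
proof -
  have char3: "(3 :: 'a) = 0"
  proof -
    \<comment> \<open>In characteristic 2 the elements \<open>0\<close>, \<open>1\<close>,
      \<open>x\<close>, \<open>x + 1\<close> would be four distinct ones. So 2 is a unit, its square
      is 1, and 3 = 4 - 1 = 0.\<close>
    have ne: "(2 :: 'a) \<noteq> 0"
    proof
      assume "(2 :: 'a) = 0"
      hence two: "x + x = 0" for x :: 'a using mult_2[of x] by simp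
      obtain x :: 'a where x: "x \<notin> {0, 1}" using exists_not_in[of "{0, 1 :: 'a}"] q by auto
      have "x + 1 \<notin> {0, 1, x}" using x two[of 1] by (auto simp: add_eq_0_iff2)
      hence "card {0, 1, x, x + 1} = 4" using x by auto
      thus False using card_mono[of UNIV "{0, 1, x, x + 1}"] q by simp
    qed
    have "(2 :: 'a) * 2 = 1" using power_card_minus_1_eq_1[OF ne] q by (simp add: power2_eq_square)
    moreover have "(3 :: 'a) = 2 * 2 - 1" by simp
    ultimately show ?thesis by simp
  qed
  have cases3: "x = 0 \<or> x = 1 \<or> x = - 1" for x :: 'a
  proof -
    have "x * ((x - 1) * (x + 1)) = x ^ 3 - x" by (simp add: algebra_simps power3_eq_cube)
    also have "\<dots> = 0" using power_card_eq_same[of x] q by simp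
    finally show ?thesis by (simp add: eq_neg_iff_add_eq_0)
  qed
  have "(1 :: 'a) + 1 + 1 = 0" using char3 by simp
  hence two: "(1 :: 'a) + 1 = - 1" by (simp only: eq_neg_iff_add_eq_0)
  hence two': "- 1 - 1 = (1 :: 'a)"
    by (metis add.inverse_inverse minus_add_distrib uminus_add_conv_diff add.commute)
  \<comment> \<open>Every element is a sum of two signs: 0 = 1 + (-1), 1 = (-1) + (-1), -1 = 1 + 1.
    These become the diagonals of the two triangular summands.\<close>
  define d where "d x = (if x = 0 then 1 else - x)" for x :: 'a
  define d' where "d' x = (if x = 0 then - 1 else - x)" for x :: 'a
  have d: "d x * d x = 1" "d' x * d' x = 1" "d x + d' x = x" for x
    using cases3[of x] two two' by (auto simp: d_def d'_def)
  let ?U = "mat n n (\<lambda>(i, j). if i < j then M $$ (i, j) else if i = j then d (M $$ (i, j)) else 0)"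
  let ?L = "mat n n (\<lambda>(i, j). if j < i then M $$ (i, j) else if i = j then d' (M $$ (i, j)) else 0)"
  obtain A where A: "A \<in> carrier_mat n n" "invertible_mat A" "A ^\<^sub>m k = ?U"
    using triangular_root_char3[of ?U n k] char3 k d by auto
  \<comment> \<open>The lower triangular summand is transposed to fit the upper triangular lemma,
    and its root is transposed back.\<close>
  obtain B where B: "B \<in> carrier_mat n n" "invertible_mat B" "B ^\<^sub>m k = transpose_mat ?L"
    using triangular_root_char3[of "transpose_mat ?L" n k] char3 k d by auto
  have "transpose_mat B ^\<^sub>m k = ?L" using pow_transpose_mat[OF B(1)] B(3) by simp
  moreover have "invertible_mat (transpose_mat B)"
    using invertible_mat_transpose[OF B(2)] .
  moreover have "M = ?U + ?L" using M d(3) by (intro eq_matI) auto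
  ultimately show thesis using that[of A "transpose_mat B"] A B(1) by simp
qed

theorem theorem1p3:
  fixes p l q n k :: nat
  assumes "prime p" and "q = p ^ l" and "CARD('a::{field, finite}) = q"
    and "n \<ge> 2" and "k \<ge> 1" and "gcd k (q - 1) = 1"
  shows "(q = 3 \<and> \<not> 3 dvd k \<longrightarrow>
            (\<forall>M \<in> carrier_mat n n. \<exists>A \<in> carrier_mat n n. \<exists>B \<in> carrier_mat n n.
               invertible_mat A \<and> invertible_mat B \<and> (M :: 'a mat) = A ^\<^sub>m k + B ^\<^sub>m k)) \<and>
         (q \<ge> 3 \<longrightarrow>
            (\<forall>M \<in> carrier_mat n n. \<exists>A \<in> carrier_mat n n. \<exists>B \<in> carrier_mat n n.
               split_semisimple A \<and> split_semisimple B \<and> (M :: 'a mat) = A ^\<^sub>m k + B ^\<^sub>m k)) \<and>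
         (q \<ge> 4 \<longrightarrow>
            (\<forall>M \<in> carrier_mat n n. \<exists>A \<in> carrier_mat n n. \<exists>B \<in> carrier_mat n n.
               invertible_mat A \<and> split_semisimple A \<and> invertible_mat B \<and> split_semisimple B \<and>
               (M :: 'a mat) = A ^\<^sub>m k + B ^\<^sub>m k))"
proof (intro conjI impI ballI)
  fix M :: "'a mat" assume M: "M \<in> carrier_mat n n"
  have k: "k \<ge> 1" "gcd k (CARD('a) - 1) = 1" using assms by auto
  {
    assume "q = 3 \<and> \<not> 3 dvd k"
    thus "\<exists>A\<in>carrier_mat n n. \<exists>B\<in>carrier_mat n n.
        invertible_mat A \<and> invertible_mat B \<and> M = A ^\<^sub>m k + B ^\<^sub>m k"
      using sum_invertible_powers_card_3[OF _ k(1) _ _ M] k assms(3) by (metis diff_Suc_1 eval_nat_numeral(3))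
  next
    \<comment> \<open>Here all field elements are allowed as eigenvalues, and each satisfies
      \<open>c^q = c\<close>.\<close>
    assume "q \<ge> 3"
    hence "\<exists>a b s :: 'a. {a, b, s, - a, - b, t - s} \<subseteq> UNIV \<and> a \<noteq> b \<and> a \<noteq> s \<and> t - s \<noteq> - a \<and> t - s \<noteq> - b" for t
      using splitting_eigenvalues[of t] assms(3) by simp
    then obtain X Y where XY: "X \<in> carrier_mat n n" "Y \<in> carrier_mat n n" "M = X + Y"
      and pow: "\<And>r r'. (\<And>c :: 'a. c ^ r = c ^ r') \<Longrightarrow> X ^\<^sub>m r = X ^\<^sub>m r'"
        "\<And>r r'. (\<And>c :: 'a. c ^ r = c ^ r') \<Longrightarrow> Y ^\<^sub>m r = Y ^\<^sub>m r'"
      using mat_eq_sum_diagonalizable[OF M, of UNIV] by (metis UNIV_I)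
    have "c ^ CARD('a) = c ^ 1" for c :: 'a by (simp add: power_card_eq_same)
    hence XYq: "X ^\<^sub>m CARD('a) = X" "Y ^\<^sub>m CARD('a) = Y"
      using pow(1)[of "CARD('a)" 1] pow(2)[of "CARD('a)" 1] XY(1,2) by simp_all
    obtain A where A: "A \<in> carrier_mat n n" "split_semisimple A" "A ^\<^sub>m k = X"
      using split_semisimple_root[OF XY(1) XYq(1) k] by blast
    obtain B where B: "B \<in> carrier_mat n n" "split_semisimple B" "B ^\<^sub>m k = Y"
      using split_semisimple_root[OF XY(2) XYq(2) k] by blast
    show "\<exists>A\<in>carrier_mat n n. \<exists>B\<in>carrier_mat n n.
        split_semisimple A \<and> split_semisimple B \<and> M = A ^\<^sub>m k + B ^\<^sub>m k"
      using A B XY(3) by blast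
  next
    assume q: "q \<ge> 4"
    obtain X Y where XY: "X \<in> carrier_mat n n" "Y \<in> carrier_mat n n" "M = X + Y"
      and pow: "\<And>r r'. (\<And>c :: 'a. c \<in> - {0} \<Longrightarrow> c ^ r = c ^ r') \<Longrightarrow> X ^\<^sub>m r = X ^\<^sub>m r'"
        "\<And>r r'. (\<And>c :: 'a. c \<in> - {0} \<Longrightarrow> c ^ r = c ^ r') \<Longrightarrow> Y ^\<^sub>m r = Y ^\<^sub>m r'"
      using mat_eq_sum_diagonalizable[OF M nonzero_splitting_eigenvalues] q assms(3) by blast
    have "c ^ CARD('a) = c ^ 1" for c :: 'a by (simp add: power_card_eq_same)
    hence XYq: "X ^\<^sub>m CARD('a) = X" "Y ^\<^sub>m CARD('a) = Y"
      using pow(1)[of "CARD('a)" 1] pow(2)[of "CARD('a)" 1] XY(1,2) by simp_all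
    \<comment> \<open>Excluding the eigenvalue 0 gives this stronger identity, which makes the roots
      invertible.\<close>
    have "c ^ (CARD('a) - 1) = c ^ 0" if "c \<in> - {0}" for c :: 'a
      using power_card_minus_1_eq_1[of c] that by simp
    hence one: "X ^\<^sub>m (CARD('a) - 1) = 1\<^sub>m n" "Y ^\<^sub>m (CARD('a) - 1) = 1\<^sub>m n"
      using pow(1)[of "CARD('a) - 1" 0] pow(2)[of "CARD('a) - 1" 0] XY(1,2) by simp_all
    obtain A where A: "A \<in> carrier_mat n n" "split_semisimple A" "A ^\<^sub>m k = X" "invertible_mat A"
      using split_semisimple_root[OF XY(1) XYq(1) k] one(1) by blast
    obtain B where B: "B \<in> carrier_mat n n" "split_semisimple B" "B ^\<^sub>m k = Y" "invertible_mat B"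
      using split_semisimple_root[OF XY(2) XYq(2) k] one(2) by blast
    show "\<exists>A\<in>carrier_mat n n. \<exists>B\<in>carrier_mat n n.
        invertible_mat A \<and> split_semisimple A \<and> invertible_mat B \<and> split_semisimple B \<and>
        M = A ^\<^sub>m k + B ^\<^sub>m k"
      using A B XY(3) by blast
  }
qed

end
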